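(* Let $\sigma:\mathbb{R}\to\mathbb{R}$ be a saturation function, let $\omega>0$, and let $b=\begin{pmatrix}b_1\\ b_2\end{pmatrix}\in\mathbb{R}^4$ with $b_1,b_2\in\mathbb{R}^2$ be such that the pair $(J_2(\omega),b)$ is controllable. Then the saturated complex double integrator $$\dot x=J_2(\omega)x-b\,\sigma(u),\qquad x\in\mathbb{R}^4,\ u\in\mathbb{R},$$ admits a stabilizing linear feedback; that is, there exists $K\in\mathbb{R}^4$ such that the closed-loop system $\dot x=J_2(\omega)x-b\,\sigma(K^Tx)$ is globally asymptotically stable with respect to the origin.
   Context: A saturation function is a function $\sigma:\mathbb{R}\to\mathbb{R}$ such that: (s1) $\sigma$ is odd and globally Lipschitz; (s2) $\sigma(\xi)\xi>0$ for every nonzero $\xi\in\mathbb{R}$, and the limits $\lim_{\xi\to+\infty}\sigma(\xi)=\sigma_\infty>0$ and $\lim_{\xi\to0}\sigma(\xi)/\xi=\sigma'(0)>0$ exist (finite); (s3) $\sigma$ is non decreasing and $\sigma'$ (defined almost everywhere) is non increasing on $\mathbb{R}_+$. Let $A_0=\begin{pmatrix}0&-1\\1&0\end{pmatrix}$, and for $\omega>0$ let $$J_2(\omega)=\begin{pmatrix}\omega A_0&I_2\\0_2&\omega A_0\end{pmatrix}\in M_4(\mathbb{R}),$$ where $I_2$ and $0_2$ are the $2\times2$ identity and zero matrices. *)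

theory Defs
  imports "HOL-Analysis.Analysis"
begin

text \<open>
  In the last clause the derivative is only compared at points where it exists; by the
  Lipschitz condition this is almost everywhere.
\<close>
definition saturation_function :: "(real \<Rightarrow> real) \<Rightarrow> bool" where
  "saturation_function \<sigma> \<longleftrightarrow>
     (\<forall>\<xi>. \<sigma> (- \<xi>) = - \<sigma> \<xi>) \<and>
     (\<exists>L. L-lipschitz_on UNIV \<sigma>) \<and>
     (\<forall>\<xi>. \<xi> \<noteq> 0 \<longrightarrow> \<sigma> \<xi> * \<xi> > 0) \<and>
     (\<exists>s>0. (\<sigma> \<longlongrightarrow> s) at_top) \<and>
     (\<exists>d0>0. ((\<lambda>\<xi>. \<sigma> \<xi> / \<xi>) \<longlongrightarrow> d0) (at 0)) \<and>
     mono \<sigma> \<and>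
     (\<forall>x y d e. 0 \<le> x \<and> x \<le> y \<and>
        (\<sigma> has_real_derivative d) (at x) \<and> (\<sigma> has_real_derivative e) (at y) \<longrightarrow> e \<le> d)"

text \<open>
  The block matrix with \<open>\<omega> A\<^sub>0\<close> in both diagonal blocks and the identity in the upper
  right block, where \<open>A\<^sub>0\<close> has rows \<open>(0, -1)\<close> and \<open>(1, 0)\<close>.
\<close>
definition J2 :: "real \<Rightarrow> real^4^4" where
  "J2 \<omega> = vector
     [vector [0, - \<omega>, 1,   0],
      vector [\<omega>,   0, 0,   1],
      vector [0,   0, 0, - \<omega>],
      vector [0,   0, \<omega>,   0]]"

text \<open>
  Controllability of \<open>x' = A x + u b\<close>: every state can be steered to every other state in
  finite time by a Lebesgue integrable control. Trajectories are solutions in the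
  Caratheodory sense, i.e. of the integral equation, since \<open>u\<close> need not be continuous.
\<close>
definition controllable :: "real^'n^'n \<Rightarrow> real^'n \<Rightarrow> bool" where
  "controllable A b \<longleftrightarrow>
     (\<forall>x0 x1. \<exists>(T::real)>0. \<exists>(u :: real \<Rightarrow> real) x.
        u absolutely_integrable_on {0..T} \<and>
        (\<forall>t\<in>{0..T}. ((\<lambda>s. A *v x s + u s *\<^sub>R b) has_integral (x t - x0)) {0..t}) \<and>
        x T = x1)"

definition forward_solution ::
  "('a::real_normed_vector \<Rightarrow> 'a) \<Rightarrow> (real \<Rightarrow> 'a) \<Rightarrow> bool" where
  "forward_solution f x \<longleftrightarrow>
     (\<forall>t\<ge>0. (x has_vector_derivative f (x t)) (at t within {0..}))"

text \<open>
  Global asymptotic stability of the origin for \<open>x' = f x\<close>: Lyapunov stability and global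
  attractivity. Existence of a forward solution from every initial state is part of the
  definition, so that the two conditions cannot hold vacuously; for Lipschitz \<open>f\<close>
  solutions are also unique, so every solution is covered.
\<close>
definition globally_asymptotically_stable ::
  "('a::real_normed_vector \<Rightarrow> 'a) \<Rightarrow> bool" where
  "globally_asymptotically_stable f \<longleftrightarrow>
     f 0 = 0 \<and>
     (\<forall>x0. \<exists>x. forward_solution f x \<and> x 0 = x0) \<and>
     (\<forall>\<epsilon>>0. \<exists>\<delta>>0. \<forall>x. forward_solution f x \<and> norm (x 0) < \<delta> \<longrightarrow>
        (\<forall>t\<ge>0. norm (x t) < \<epsilon>)) \<and>
     (\<forall>x. forward_solution f x \<longrightarrow> (x \<longlongrightarrow> 0) at_top)"

end

theory Submission
  imports Defs
begin

text \<open>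
  Controllability amounts to \<open>b\<^sub>2 \<noteq> 0\<close>. A complex change of coordinates then moves \<open>b\<close> to
  \<open>(0, 1)\<close>, and in the frame rotating with angular velocity \<open>\<omega>\<close> the system becomes
  \<open>v' = w - k2 \<psi> e\<close>, \<open>w' = - k1 \<psi> e\<close>, where \<open>e t = exp (- i \<omega> t)\<close>, \<open>u = Re (v / e)\<close> and
  \<open>\<psi> = \<sigma> u\<close>. Let \<open>h = \<pi> / \<omega>\<close> be half a period, so that \<open>e (t - h) = - e t\<close>, and let \<open>\<Sigma>\<close> be the
  even convex primitive of \<open>\<sigma>\<close>. The Lyapunov functional is
  \<open>V t = \<integral>_{t-h}^t \<Sigma> (u s) ds + h |w t|^2 / (2 k1)\<close>. Convexity bounds \<open>\<Sigma> (u t) - \<Sigma> (u (t - h))\<close> by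
  \<open>\<psi> t (u t + u (t - h)) - D^2 / (2 L)\<close>, where \<open>D t = \<psi> t + \<psi> (t - h)\<close>; the first term contains
  \<open>h \<psi> Re (w / e)\<close>, which the derivative of \<open>|w|^2\<close> cancels exactly, however large \<open>w\<close> is.

  Over half a period \<open>V\<close> therefore drops by \<open>k2 |J|^2\<close>, where \<open>J = \<integral> \<psi> e\<close>, plus a multiple of
  \<open>(\<integral> |D|)^2\<close>, up to errors of higher order in the gains. Either \<open>\<psi>\<close> is nearly antiperiodic, and
  then \<open>|J|\<close> is comparable to \<open>\<integral> |\<psi>|\<close>, or \<open>\<integral> |D|\<close> is. For small \<open>k2\<close> and \<open>k1 << k2\<close> the drop is
  thus at least a multiple of \<open>(\<integral> |\<psi>|)^2\<close>, and a small \<open>\<integral> |\<psi>|\<close> forces a small state.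
\<close>

section \<open>Saturation functions and monotonicity\<close>

text \<open>On the nonnegative axis \<open>\<sigma>\<close> lies between \<open>m * min x 1\<close>
  and \<open>M * min x 1\<close>: the slope at 0 and monotonicity give the lower bound, the
  Lipschitz condition and the limit at infinity the upper one. Since
  \<open>c * min x 1 \<le> min (c * x) 1\<close> for \<open>c\<close> in the unit interval, the
  scaling bound holds with the ratio \<open>\<gamma> = m / M\<close>.\<close>

lemma saturation_function_bounds:
  assumes "saturation_function \<sigma>"
  obtains L m \<gamma> where "L > 0" "m > 0" "0 < \<gamma>" "\<gamma> \<le> 1"
    "\<And>x y. \<bar>\<sigma> x - \<sigma> y\<bar> \<le> L * \<bar>x - y\<bar>"
    "\<And>x. 0 \<le> x \<Longrightarrow> m * min x 1 \<le> \<sigma> x"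
    "\<And>x c. 0 \<le> x \<Longrightarrow> 0 \<le> c \<Longrightarrow> c \<le> 1 \<Longrightarrow> \<gamma> * c * \<sigma> x \<le> \<sigma> (c * x)"
proof -
  obtain L0 s d0 where odd: "\<And>x. \<sigma> (- x) = - \<sigma> x"
    and lip: "L0-lipschitz_on UNIV \<sigma>"
    and s: "s > 0" "(\<sigma> \<longlongrightarrow> s) at_top"
    and d0: "d0 > 0" "((\<lambda>\<xi>. \<sigma> \<xi> / \<xi>) \<longlongrightarrow> d0) (at 0)"
    and mono: "mono \<sigma>"
    using assms unfolding saturation_function_def by blast
  define L where "L = L0 + 1"
  have L0: "L0 \<ge> 0" using lip lipschitz_on_nonneg by blast
  have L: "L > 0" using L0 by (simp add: L_def)
  have lipL: "\<bar>\<sigma> x - \<sigma> y\<bar> \<le> L * \<bar>x - y\<bar>" for x y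
  proof -
    have "\<bar>\<sigma> x - \<sigma> y\<bar> \<le> L0 * \<bar>x - y\<bar>"
      using lipschitz_onD[OF lip, of x y] by (simp add: dist_real_def)
    also have "\<dots> \<le> L * \<bar>x - y\<bar>" by (intro mult_right_mono) (auto simp: L_def)
    finally show ?thesis .
  qed
  have zero: "\<sigma> 0 = 0" using odd[of 0] by simp
  obtain r where r: "r > 0" "\<And>x. x \<noteq> 0 \<Longrightarrow> \<bar>x\<bar> < r \<Longrightarrow> \<sigma> x / x > d0 / 2"
  proof -
    have "\<forall>\<^sub>F x in at 0. \<sigma> x / x > d0 / 2"
      using d0 by (intro order_tendstoD(1)[OF d0(2)]) simp
    then show ?thesis using that unfolding eventually_at by (auto simp: dist_real_def)
  qed
  define d where "d = min (r / 2) 1"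
  have d: "0 < d" "d \<le> 1" "d < r" using r(1) by (auto simp: d_def)
  have near: "d0 / 2 * x \<le> \<sigma> x" if "0 \<le> x" "x \<le> d" for x
  proof (cases "x = 0")
    case False
    then have "\<sigma> x / x > d0 / 2" using r(2)[of x] that d by auto
    then show ?thesis using False that by (simp add: field_simps)
  qed (simp add: zero)
  \<comment> \<open>The value at \<open>d\<close> of the linear lower bound. As
    \<open>d \<le> 1\<close>, it is also at most the slope \<open>d0 / 2\<close>, so the same
    constant serves below and above \<open>d\<close>.\<close>
  define m where "m = d0 / 2 * d"
  have m: "m > 0" using d d0 by (simp add: m_def)
  have lower: "m * min x 1 \<le> \<sigma> x" if "0 \<le> x" for x
  proof (cases "x \<le> d")
    case True
    have "m * min x 1 \<le> (d0 / 2 * 1) * x"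
      unfolding m_def using d d0 that by (intro mult_mono) auto
    then show ?thesis using near[OF that True] by simp
  next
    case False
    have "m * min x 1 \<le> m * 1" using m by (intro mult_left_mono) auto
    also have "\<dots> \<le> \<sigma> d" using near[of d] d by (simp add: m_def)
    also have "\<dots> \<le> \<sigma> x" using False mono by (auto intro: monoD)
    finally show ?thesis .
  qed
  have le_s: "\<sigma> x \<le> s" for x
  proof (rule tendsto_lowerbound[OF s(2)])
    show "\<forall>\<^sub>F y in at_top. \<sigma> x \<le> \<sigma> y"
      using eventually_ge_at_top[of x] by eventually_elim (rule monoD[OF mono])
  qed simp
  define M where "M = max L s"
  have M: "M > 0" using L by (simp add: M_def)
  have upper: "\<sigma> x \<le> M * min x 1" if "0 \<le> x" for x
  proof -
    have "\<sigma> x \<le> L * x" using lipL[of x 0] zero that by simp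
    also have "\<dots> \<le> M * x" using that by (intro mult_right_mono) (auto simp: M_def)
    finally have "\<sigma> x \<le> M * x" .
    moreover have "\<sigma> x \<le> M" using le_s[of x] by (simp add: M_def)
    ultimately show ?thesis by (simp add: min_def)
  qed
  define \<gamma> where "\<gamma> = m / M"
  have "m \<le> M" using lower[of 1] upper[of 1] by simp
  then have \<gamma>: "0 < \<gamma>" "\<gamma> \<le> 1" using m M by (auto simp: \<gamma>_def)
  have scale: "\<gamma> * c * \<sigma> x \<le> \<sigma> (c * x)" if "0 \<le> x" "0 \<le> c" "c \<le> 1" for x c
  proof -
    have "\<gamma> * c * \<sigma> x \<le> \<gamma> * c * (M * min x 1)"
      using upper[OF that(1)] \<gamma> that by (intro mult_left_mono) auto
    also have "\<dots> = m * (c * min x 1)" using M by (simp add: \<gamma>_def)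
    also have "\<dots> \<le> m * min (c * x) 1"
      using that m mult_left_mono[of 1 x c]
      by (intro mult_left_mono) (auto simp: min_def mult_left_le mult_le_one)
    also have "\<dots> \<le> \<sigma> (c * x)" using lower[of "c * x"] that by simp
    finally show ?thesis .
  qed
  show ?thesis using that[OF L m \<gamma> lipL lower scale] .
qed

text \<open>Replaces integral estimates: a bound over a window is proved by differentiating
  antiderivatives of both sides. Together with the two monotonicity lemmas below it carries the
  estimates along trajectories.\<close>

lemma norm_diff_le_by_derivative:
  fixes f :: "real \<Rightarrow> 'a::real_normed_vector"
  assumes "a \<le> b"
    and f: "\<And>t. a \<le> t \<Longrightarrow> t \<le> b \<Longrightarrow> (f has_vector_derivative f' t) (at t)"
    and g: "\<And>t. a \<le> t \<Longrightarrow> t \<le> b \<Longrightarrow> (g has_real_derivative g' t) (at t)"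
    and le: "\<And>t. a \<le> t \<Longrightarrow> t \<le> b \<Longrightarrow> norm (f' t) \<le> g' t"
  shows "norm (f b - f a) \<le> g b - g a"
proof (cases "a = b")
  case False
  show ?thesis
  proof (rule differentiable_bound_general)
    show "a < b" using assms False by simp
    show "continuous_on {a..b} f"
      by (intro continuous_at_imp_continuous_on ballI) (auto intro: has_vector_derivative_continuous f)
    show "continuous_on {a..b} g"
      by (intro continuous_at_imp_continuous_on ballI) (auto intro: DERIV_isCont g)
    show "(g has_vector_derivative g' t) (at t)" if "a < t" "t < b" for t
      using g that by (simp add: has_real_derivative_iff_has_vector_derivative)
    show "(f has_vector_derivative f' t) (at t)" if "a < t" "t < b" for t
      using f that by simp
    show "norm (f' t) \<le> g' t" if "a < t" "t < b" for t
      using le that by simp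
  qed
qed auto

lemma le_by_derivative:
  fixes f :: "real \<Rightarrow> real"
  assumes "a \<le> b"
    and "\<And>t. a \<le> t \<Longrightarrow> t \<le> b \<Longrightarrow> (f has_real_derivative f' t) (at t)"
    and "\<And>t. a \<le> t \<Longrightarrow> t \<le> b \<Longrightarrow> f' t \<le> 0"
  shows "f b \<le> f a"
  using DERIV_nonpos_imp_nonincreasing[OF assms(1)] assms(2,3) by blast

lemma ge_by_derivative:
  fixes f :: "real \<Rightarrow> real"
  assumes "a \<le> b"
    and "\<And>t. a \<le> t \<Longrightarrow> t \<le> b \<Longrightarrow> (f has_real_derivative f' t) (at t)"
    and "\<And>t. a \<le> t \<Longrightarrow> t \<le> b \<Longrightarrow> 0 \<le> f' t"
  shows "f a \<le> f b"
  using DERIV_nonneg_imp_nondecreasing[OF assms(1)] assms(2,3) by blast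

lemma has_vector_derivative_inner:
  fixes f g :: "real \<Rightarrow> 'a::real_inner"
  assumes "(f has_vector_derivative f') (at x within S)" "(g has_vector_derivative g') (at x within S)"
  shows "((\<lambda>t. f t \<bullet> g t) has_real_derivative (f x \<bullet> g' + f' \<bullet> g x)) (at x within S)"
  using bounded_bilinear.has_vector_derivative[OF bounded_bilinear_inner assms]
  by (simp add: has_real_derivative_iff_has_vector_derivative)

lemma antiderivative_at_greaterThan:
  fixes f :: "real \<Rightarrow> real"
  assumes "\<And>x. x > a \<Longrightarrow> isCont f x"
  obtains F where "\<And>x. x > a \<Longrightarrow> (F has_real_derivative f x) (at x)"
  using einterval_antiderivative[of "ereal a" \<infinity> f] assms
  by (auto simp: has_real_derivative_iff_has_vector_derivative)

lemma has_real_derivative_shift: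
  assumes "(f has_real_derivative f') (at (x - c))"
  shows "((\<lambda>t. f (t - c)) has_real_derivative f') (at x)"
  using DERIV_shift[of f f' x "-c"] assms by simp

lemma has_vector_derivative_shift:
  assumes "(f has_vector_derivative f') (at (x - c))"
  shows "((\<lambda>t. f (t - c)) has_vector_derivative f') (at x)"
  using vector_diff_chain_at[of "\<lambda>t. t - c" 1 x f f'] assms
  by (simp add: o_def has_vector_derivative_diff_const)

section \<open>The rotating frame\<close>

text \<open>The three smallness conditions have separate tasks: \<open>slow1\<close> absorbs the
  error of freezing the state, \<open>slow2\<close> makes \<open>h * k1\<close> small against
  \<open>k2\<close>, and \<open>slow3\<close> lets the dissipation in \<open>D\<close> absorb every
  other quadratic term in the antiperiodicity defect.\<close>

locale slow_saturated_feedback =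
  fixes \<sigma> \<Sigma> :: "real \<Rightarrow> real" and L m \<gamma> \<omega> k1 k2 h :: real
  defines "h \<equiv> pi / \<omega>"
  assumes L: "L > 0" and m: "m > 0" and \<gamma>: "0 < \<gamma>" "\<gamma> \<le> 1" and \<omega>: "\<omega> > 0"
    and k1: "k1 > 0" and k2: "k2 > 0"
    and odd: "\<sigma> (- x) = - \<sigma> x"
    and mono: "mono \<sigma>"
    and lip: "\<bar>\<sigma> x - \<sigma> y\<bar> \<le> L * \<bar>x - y\<bar>"
    and lower: "0 \<le> x \<Longrightarrow> m * min x 1 \<le> \<sigma> x"
    and scale: "0 \<le> x \<Longrightarrow> 0 \<le> c \<Longrightarrow> c \<le> 1 \<Longrightarrow> \<gamma> * c * \<sigma> x \<le> \<sigma> (c * x)"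
    and \<Sigma>: "(\<Sigma> has_real_derivative \<sigma> x) (at x)" and \<Sigma>0: "\<Sigma> 0 = 0"
    and slow1: "16 * h * L * (k2 + h * k1) \<le> \<gamma>"
    and slow2: "128 * h * k1 \<le> k2 * \<gamma>\<^sup>2"
    and slow3: "2 * L * h * k2 * (9 + 64 / \<gamma>\<^sup>2) \<le> 1"
begin

lemma h: "h > 0" using \<omega> by (simp add: h_def)

lemma \<sigma>0 [simp]: "\<sigma> 0 = 0" using odd[of 0] by simp

lemma isCont_\<sigma>: "isCont \<sigma> x"
proof -
  have "L-lipschitz_on UNIV \<sigma>" using lip L by (auto intro!: lipschitz_onI simp: dist_real_def)
  then show ?thesis using lipschitz_on_continuous_on continuous_on_eq_continuous_at by blast
qed

section \<open>Convexity and smoothness of the primitive of \<open>\<sigma>\<close>\<close>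

lemma \<Sigma>_tangent: "\<Sigma> a + \<sigma> a * (b - a) \<le> \<Sigma> b"
proof (cases "a \<le> b")
  case True
  have "\<sigma> a * b - \<Sigma> b \<le> \<sigma> a * a - \<Sigma> a"
    by (rule le_by_derivative[OF True, where f' = "\<lambda>x. \<sigma> a - \<sigma> x"])
       (auto intro!: derivative_eq_intros \<Sigma> monoD[OF mono])
  then show ?thesis by (simp add: algebra_simps)
next
  case False
  have "\<Sigma> a - \<sigma> a * a \<le> \<Sigma> b - \<sigma> a * b"
  proof (rule le_by_derivative[where f = "\<lambda>x. \<Sigma> x - \<sigma> a * x" and f' = "\<lambda>x. \<sigma> x - \<sigma> a"])
    fix x assume "b \<le> x" "x \<le> a"
    then show "\<sigma> x - \<sigma> a \<le> 0" using monoD[OF mono] by simp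
  qed (use False in \<open>auto intro!: derivative_eq_intros \<Sigma>\<close>)
  then show ?thesis by (simp add: algebra_simps)
qed

lemma \<Sigma>_descent: "\<Sigma> b \<le> \<Sigma> a + \<sigma> a * (b - a) + L / 2 * (b - a)\<^sup>2"
proof (cases "a \<le> b")
  case True
  have "\<Sigma> b - \<sigma> a * (b - a) - L / 2 * (b - a)\<^sup>2 \<le> \<Sigma> a - \<sigma> a * (a - a) - L / 2 * (a - a)\<^sup>2"
  proof (rule le_by_derivative[OF True, where f' = "\<lambda>x. \<sigma> x - \<sigma> a - L * (x - a)"])
    fix x assume "a \<le> x" "x \<le> b"
    then show "\<sigma> x - \<sigma> a - L * (x - a) \<le> 0" using lip[of x a] by simp
  qed (auto intro!: derivative_eq_intros \<Sigma>)
  then show ?thesis by simp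
next
  case False
  have "- (\<Sigma> a - \<sigma> a * (a - a) - L / 2 * (a - a)\<^sup>2) \<le> - (\<Sigma> b - \<sigma> a * (b - a) - L / 2 * (b - a)\<^sup>2)"
  proof (rule le_by_derivative[where f = "\<lambda>x. - (\<Sigma> x - \<sigma> a * (x - a) - L / 2 * (x - a)\<^sup>2)"
        and f' = "\<lambda>x. - (\<sigma> x - \<sigma> a - L * (x - a))"])
    fix x assume "b \<le> x" "x \<le> a"
    then show "- (\<sigma> x - \<sigma> a - L * (x - a)) \<le> 0" using lip[of x a] by (simp add: algebra_simps)
  qed (use False in \<open>auto intro!: derivative_eq_intros \<Sigma>\<close>)
  then show ?thesis by simp
qed

text \<open>The tangent at \<open>a\<close> and the descent bound at \<open>b\<close> are compared
  at one gradient step from \<open>b\<close>, the point \<open>y\<close> that minimises the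
  quadratic upper bound minus the tangent slope. The gained square becomes the dissipation in
  \<open>D\<close>.\<close>

lemma \<Sigma>_cocoercive: "\<Sigma> a - \<Sigma> b \<le> \<sigma> a * (a - b) - (\<sigma> a - \<sigma> b)\<^sup>2 / (2 * L)"
proof -
  define y where "y = b - (\<sigma> b - \<sigma> a) / L"
  have y: "y - b = (\<sigma> a - \<sigma> b) / L" by (simp add: y_def diff_divide_distrib)
  have "\<Sigma> a + \<sigma> a * (y - a) \<le> \<Sigma> b + \<sigma> b * (y - b) + L / 2 * (y - b)\<^sup>2"
    using \<Sigma>_tangent[of a y] \<Sigma>_descent[of y b] by simp
  then have "\<Sigma> a - \<Sigma> b \<le> \<sigma> a * (a - b) + (\<sigma> b - \<sigma> a) * (y - b) + L / 2 * (y - b)\<^sup>2"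
    by (simp add: algebra_simps)
  moreover have "(\<sigma> b - \<sigma> a) * (y - b) + L / 2 * (y - b)\<^sup>2 = - (\<sigma> a - \<sigma> b)\<^sup>2 / (2 * L)"
    unfolding y power_divide power2_eq_square using L by (simp add: divide_simps) (simp add: algebra_simps)
  ultimately show ?thesis by (simp add: algebra_simps)
qed

lemma \<Sigma>_nonneg: "0 \<le> \<Sigma> x" using \<Sigma>_tangent[of 0 x] by (simp add: \<Sigma>0)

lemma \<Sigma>_le: "\<Sigma> x \<le> L / 2 * x\<^sup>2" using \<Sigma>_descent[of x 0] by (simp add: \<Sigma>0)

lemma \<Sigma>_even: "\<Sigma> (- x) = \<Sigma> x"
proof -
  have "((\<lambda>y. \<Sigma> (- y) - \<Sigma> y) has_real_derivative 0) (at y)" for y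
    by (auto intro!: derivative_eq_intros DERIV_chain2[OF \<Sigma>] simp: odd \<Sigma>)
  from DERIV_isconst_all[of "\<lambda>y. \<Sigma> (- y) - \<Sigma> y" x 0] this show ?thesis by simp
qed

definition e :: "real \<Rightarrow> complex" where "e t = cis (- (\<omega> * t))"

lemma norm_e [simp]: "norm (e t) = 1" by (simp add: e_def)

lemma e_shift [simp]: "e (t - h) = - e t"
proof -
  have "- (\<omega> * (t - h)) = - (\<omega> * t) + pi" using \<omega> by (simp add: h_def algebra_simps)
  then have "e (t - h) = cis (- (\<omega> * t)) * cis pi" unfolding e_def by (simp only: cis_mult)
  then show ?thesis by (simp add: e_def)
qed

lemma inner_e_le: "\<bar>x \<bullet> e t\<bar> \<le> norm x"
  using Cauchy_Schwarz_ineq2[of x "e t"] by simp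

end

text \<open>Derivatives are required only for \<open>t > 0\<close>, because a forward solution has
  merely a one-sided derivative at 0. Quantities that look back by \<open>h\<close> are accordingly
  handled only after time \<open>h\<close>.\<close>

locale slow_trajectory = slow_saturated_feedback +
  fixes v w :: "real \<Rightarrow> complex" and u \<psi> :: "real \<Rightarrow> real"
  defines "u \<equiv> \<lambda>t. v t \<bullet> e t" and "\<psi> \<equiv> \<lambda>t. \<sigma> (u t)"
  assumes v': "t > 0 \<Longrightarrow> (v has_vector_derivative w t - (k2 * \<psi> t) *\<^sub>R e t) (at t)"
    and w': "t > 0 \<Longrightarrow> (w has_vector_derivative - (k1 * \<psi> t) *\<^sub>R e t) (at t)"
begin

section \<open>Running integrals and drift along a trajectory\<close>

lemma isCont_u: "t > 0 \<Longrightarrow> isCont u t"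
proof -
  assume t: "t > 0"
  have "isCont v t" by (rule has_vector_derivative_continuous[OF v'[OF t]])
  moreover have "isCont e t"
    unfolding e_def[abs_def] cis_conv_exp by (intro continuous_intros)
  ultimately show ?thesis unfolding u_def by (intro continuous_intros)
qed

lemma isCont_\<psi>: "t > 0 \<Longrightarrow> isCont \<psi> t"
  unfolding \<psi>_def by (rule isCont_o2[OF isCont_u isCont_\<sigma>])

definition D :: "real \<Rightarrow> real" where "D t = \<psi> t + \<psi> (t - h)"

lemma isCont_D: "t > h \<Longrightarrow> isCont D t"
proof -
  assume t: "t > h"
  have "isCont (\<lambda>t. \<psi> (t - h)) t"
    by (rule isCont_o2[where f = "\<lambda>t. t - h"]) (use isCont_\<psi>[of "t - h"] t in auto)
  then show ?thesis
    using isCont_\<psi>[of t] t h unfolding D_def[abs_def] by (intro continuous_intros) auto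
qed

text \<open>\<open>P\<close>, \<open>N\<close> and \<open>S\<close> stand for the running integrals
  of \<open>|\<psi>|\<close>, \<open>|D|\<close> and \<open>\<Sigma> (u t)\<close>. As chosen
  antiderivatives on an open half-line they are fixed only up to a constant, and only their
  increments enter the estimates.\<close>

definition P :: "real \<Rightarrow> real" where
  "P = (SOME F. \<forall>t>0. (F has_real_derivative \<bar>\<psi> t\<bar>) (at t))"

definition N :: "real \<Rightarrow> real" where
  "N = (SOME F. \<forall>t>h. (F has_real_derivative \<bar>D t\<bar>) (at t))"

definition S :: "real \<Rightarrow> real" where
  "S = (SOME F. \<forall>t>0. (F has_real_derivative \<Sigma> (u t)) (at t))"

lemma P': "t > 0 \<Longrightarrow> (P has_real_derivative \<bar>\<psi> t\<bar>) (at t)"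
proof -
  have "\<exists>F. \<forall>t>0. (F has_real_derivative \<bar>\<psi> t\<bar>) (at t)"
    using antiderivative_at_greaterThan[of 0 "\<lambda>t. \<bar>\<psi> t\<bar>"] isCont_\<psi> continuous_rabs by metis
  from someI_ex[OF this] show "t > 0 \<Longrightarrow> (P has_real_derivative \<bar>\<psi> t\<bar>) (at t)"
    unfolding P_def by blast
qed

lemma N': "t > h \<Longrightarrow> (N has_real_derivative \<bar>D t\<bar>) (at t)"
proof -
  have "\<exists>F. \<forall>t>h. (F has_real_derivative \<bar>D t\<bar>) (at t)"
    using antiderivative_at_greaterThan[of h "\<lambda>t. \<bar>D t\<bar>"] isCont_D continuous_rabs by metis
  from someI_ex[OF this] show "t > h \<Longrightarrow> (N has_real_derivative \<bar>D t\<bar>) (at t)"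
    unfolding N_def by blast
qed

lemma S': "t > 0 \<Longrightarrow> (S has_real_derivative \<Sigma> (u t)) (at t)"
proof -
  have "isCont (\<lambda>t. \<Sigma> (u t)) t" if "t > 0" for t
    using isCont_o2[OF isCont_u[OF that]] DERIV_isCont[OF \<Sigma>] by blast
  then have "\<exists>F. \<forall>t>0. (F has_real_derivative \<Sigma> (u t)) (at t)"
    using antiderivative_at_greaterThan[of 0 "\<lambda>t. \<Sigma> (u t)"] by metis
  from someI_ex[OF this] show "t > 0 \<Longrightarrow> (S has_real_derivative \<Sigma> (u t)) (at t)"
    unfolding S_def by blast
qed

lemma P_mono: "0 < a \<Longrightarrow> a \<le> b \<Longrightarrow> P a \<le> P b"
  by (rule ge_by_derivative[where f' = "\<lambda>t. \<bar>\<psi> t\<bar>"]) (use h in \<open>auto intro!: P'\<close>)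

lemma N_mono: "h < a \<Longrightarrow> a \<le> b \<Longrightarrow> N a \<le> N b"
  by (rule ge_by_derivative[where f' = "\<lambda>t. \<bar>D t\<bar>"]) (use h in \<open>auto intro!: N'\<close>)

lemma S_mono: "0 < a \<Longrightarrow> a \<le> b \<Longrightarrow> S a \<le> S b"
  by (rule ge_by_derivative[where f' = "\<lambda>t. \<Sigma> (u t)"]) (use \<Sigma>_nonneg in \<open>auto intro!: S'\<close>)

lemma w_diff: "0 < a \<Longrightarrow> a \<le> b \<Longrightarrow> norm (w b - w a) \<le> k1 * (P b - P a)"
proof -
  assume ab: "0 < a" "a \<le> b"
  have "norm (w b - w a) \<le> k1 * P b - k1 * P a"
    by (rule norm_diff_le_by_derivative[OF ab(2) w' DERIV_cmult[OF P']])
       (use ab k1 in \<open>auto simp: abs_mult\<close>)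
  then show ?thesis by (simp add: algebra_simps)
qed

text \<open>Subtracting \<open>(k2 / k1) w\<close> from \<open>v\<close> removes the forcing term.\<close>

lemma y_drift:
  assumes "0 < a" "a \<le> c" "c \<le> b"
  shows "norm (v b - v a - (b - a) *\<^sub>R w c - (k2 / k1) *\<^sub>R (w b - w a)) \<le> (b - a) * (k1 * (P b - P a))"
proof -
  have "norm ((v b - b *\<^sub>R w c - (k2 / k1) *\<^sub>R w b) - (v a - a *\<^sub>R w c - (k2 / k1) *\<^sub>R w a))
        \<le> (k1 * (P b - P a)) * b - (k1 * (P b - P a)) * a"
  proof (rule norm_diff_le_by_derivative)
    show "a \<le> b" using assms by simp
    fix t assume t: "a \<le> t" "t \<le> b"
    show "((\<lambda>t. v t - t *\<^sub>R w c - (k2 / k1) *\<^sub>R w t) has_vector_derivative w t - w c) (at t)"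
    proof -
      have "t > 0" using t assms by simp
      then have "((\<lambda>t. v t - t *\<^sub>R w c - (k2 / k1) *\<^sub>R w t) has_vector_derivative
          (w t - (k2 * \<psi> t) *\<^sub>R e t) - (t *\<^sub>R 0 + 1 *\<^sub>R w c) - (k2 / k1) *\<^sub>R (- (k1 * \<psi> t) *\<^sub>R e t)) (at t)"
        by (intro has_vector_derivative_diff v' w' has_vector_derivative_scaleR DERIV_ident
            has_vector_derivative_const bounded_linear.has_vector_derivative[OF bounded_linear_scaleR_right])
      then show ?thesis using k1 by simp
    qed
    show "((\<lambda>t. k1 * (P b - P a) * t) has_real_derivative k1 * (P b - P a)) (at t)"
      by (auto intro!: derivative_eq_intros)
    show "norm (w t - w c) \<le> k1 * (P b - P a)"
    proof (cases "c \<le> t")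
      case True
      have "norm (w t - w c) \<le> k1 * (P t - P c)" using w_diff[of c t] assms True by simp
      also have "\<dots> \<le> k1 * (P b - P a)"
        using P_mono[of a c] P_mono[of t b] assms t k1 by (intro mult_left_mono) auto
      finally show ?thesis .
    next
      case False
      have "norm (w t - w c) \<le> k1 * (P c - P t)"
        using w_diff[of t c] assms t False by (simp add: norm_minus_commute)
      also have "\<dots> \<le> k1 * (P b - P a)"
        using P_mono[of c b] P_mono[of a t] assms t k1 by (intro mult_left_mono) auto
      finally show ?thesis .
    qed
  qed
  then show ?thesis by (simp add: algebra_simps)
qed

text \<open>Putting the multiple of \<open>w\<close> back costs \<open>k2 * (P b - P a)\<close> by
  \<open>w_diff\<close>. Over a window \<open>v\<close> is thus affine with slope
  \<open>w c\<close>, up to an error governed by the control effort alone, however large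
  \<open>w\<close> is.\<close>

lemma v_drift:
  assumes "0 < a" "a \<le> c" "c \<le> b"
  shows "norm (v b - v a - (b - a) *\<^sub>R w c) \<le> (k2 + (b - a) * k1) * (P b - P a)"
proof -
  have "norm ((k2 / k1) *\<^sub>R (w b - w a)) \<le> (k2 / k1) * (k1 * (P b - P a))"
    using mult_left_mono[OF w_diff[of a b], of "k2 / k1"] assms k1 k2 by simp
  then have "norm ((k2 / k1) *\<^sub>R (w b - w a)) \<le> k2 * (P b - P a)" using k1 by simp
  moreover have "norm (v b - v a - (b - a) *\<^sub>R w c) \<le>
      norm (v b - v a - (b - a) *\<^sub>R w c - (k2 / k1) *\<^sub>R (w b - w a)) + norm ((k2 / k1) *\<^sub>R (w b - w a))"
    using norm_triangle_ineq[of "v b - v a - (b - a) *\<^sub>R w c - (k2 / k1) *\<^sub>R (w b - w a)" "(k2 / k1) *\<^sub>R (w b - w a)"]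
    by simp
  ultimately show ?thesis using y_drift[OF assms] by (simp add: algebra_simps)
qed

end

section \<open>Decay of the Lyapunov functional\<close>

context slow_trajectory
begin

definition V :: "real \<Rightarrow> real" where
  "V t = S t - S (t - h) + h / (2 * k1) * (w t \<bullet> w t)"

text \<open>Since the derivative of \<open>w\<close> is \<open>- k1 \<psi> e\<close>, this is the
  integral of \<open>\<psi> e\<close> over the last half period. Likewise \<open>\<Psi>\<close> and
  \<open>\<Delta>\<close> below are the integrals of \<open>|\<psi>|\<close> and \<open>|D|\<close>
  over that window.\<close>

definition J :: "real \<Rightarrow> complex" where
  "J t = - (1 / k1) *\<^sub>R (w t - w (t - h))"

definition \<Psi> :: "real \<Rightarrow> real" where "\<Psi> t = P t - P (t - h)"

definition \<Delta> :: "real \<Rightarrow> real" where "\<Delta> t = N t - N (t - h)"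

lemma w_J: "w t - w (t - h) = - k1 *\<^sub>R J t"
  using k1 by (simp add: J_def)

lemma V_nonneg: "t > h \<Longrightarrow> 0 \<le> V t"
  using S_mono[of "t - h" t] h k1 by (simp add: V_def)

lemma \<Psi>_nonneg: "t > h \<Longrightarrow> 0 \<le> \<Psi> t"
  using P_mono[of "t - h" t] h by (simp add: \<Psi>_def)

lemma \<Delta>_nonneg: "t > 2 * h \<Longrightarrow> 0 \<le> \<Delta> t"
  using N_mono[of "t - h" t] h by (simp add: \<Delta>_def)

text \<open>The shift by half a period flips the sign of \<open>e\<close>, so the two endpoint terms
  add up to \<open>D\<close> instead of cancelling: \<open>J\<close> moves only as far as
  \<open>\<psi>\<close> fails to be antiperiodic.\<close>

lemma J': "t > h \<Longrightarrow> (J has_vector_derivative D t *\<^sub>R e t) (at t)"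
proof -
  assume t: "t > h"
  have "t > 0" "t - h > 0" using t h by auto
  then have "((\<lambda>t. - (1 / k1) *\<^sub>R (w t - w (t - h))) has_vector_derivative
      - (1 / k1) *\<^sub>R (- (k1 * \<psi> t) *\<^sub>R e t - - (k1 * \<psi> (t - h)) *\<^sub>R e (t - h))) (at t)"
    by (intro bounded_linear.has_vector_derivative[OF bounded_linear_scaleR_right]
        has_vector_derivative_diff w' has_vector_derivative_shift)
  then show "(J has_vector_derivative D t *\<^sub>R e t) (at t)"
    using k1 unfolding J_def[abs_def] D_def e_shift by (simp add: algebra_simps)
qed

lemma \<Psi>': "t > h \<Longrightarrow> (\<Psi> has_real_derivative \<bar>\<psi> t\<bar> - \<bar>\<psi> (t - h)\<bar>) (at t)"
  unfolding \<Psi>_def[abs_def] using h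
  by (intro DERIV_diff P' has_real_derivative_shift) auto

lemma V': "t > h \<Longrightarrow> (V has_real_derivative
    \<Sigma> (u t) - \<Sigma> (u (t - h)) - h * \<psi> t * (w t \<bullet> e t)) (at t)"
proof -
  assume t: "t > h"
  have "t > 0" "t - h > 0" using t h by auto
  then have "(V has_real_derivative
      (\<Sigma> (u t) - \<Sigma> (u (t - h)))
      + h / (2 * k1) * (w t \<bullet> (- (k1 * \<psi> t) *\<^sub>R e t) + (- (k1 * \<psi> t) *\<^sub>R e t) \<bullet> w t)) (at t)"
    unfolding V_def[abs_def]
    by (intro DERIV_add DERIV_cmult DERIV_diff S' has_real_derivative_shift
        has_vector_derivative_inner w')
  then show "(V has_real_derivative
    \<Sigma> (u t) - \<Sigma> (u (t - h)) - h * \<psi> t * (w t \<bullet> e t)) (at t)"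
    using k1 by (simp add: inner_commute algebra_simps)
qed

text \<open>Evenness of \<open>\<Sigma>\<close> allows comparing \<open>u t\<close> with
  \<open>- u (t - h)\<close>, and \<open>u t + u (t - h)\<close> is the increment of
  \<open>v\<close> along \<open>e t\<close>. By \<open>y_drift\<close> this increment splits into
  \<open>h w\<close>, which the derivative of the quadratic term cancels, the dissipative part
  \<open>- k2 J\<close>, and a remainder \<open>R\<close> of order \<open>h * k1\<close>.\<close>

lemma V_rate:
  assumes t: "t > h"
  shows "\<Sigma> (u t) - \<Sigma> (u (t - h)) - h * \<psi> t * (w t \<bullet> e t)
    \<le> - k2 * (\<psi> t * (J t \<bullet> e t)) + \<bar>\<psi> t\<bar> * (h * (k1 * \<Psi> t)) - (D t)\<^sup>2 / (2 * L)"
proof -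
  define R where "R = v t - v (t - h) - h *\<^sub>R w t - (k2 / k1) *\<^sub>R (w t - w (t - h))"
  have R: "norm R \<le> h * (k1 * \<Psi> t)"
    using y_drift[of "t - h" t t] t h by (simp add: R_def \<Psi>_def)
  have vd: "v t - v (t - h) = h *\<^sub>R w t - k2 *\<^sub>R J t + R"
    unfolding R_def w_J using k1 by simp
  have "u t + u (t - h) = (v t - v (t - h)) \<bullet> e t"
    by (simp add: u_def inner_diff_left)
  also have "\<dots> = h * (w t \<bullet> e t) - k2 * (J t \<bullet> e t) + R \<bullet> e t"
    unfolding vd by (simp add: inner_diff_left inner_add_left)
  finally have uu: "u t + u (t - h) = h * (w t \<bullet> e t) - k2 * (J t \<bullet> e t) + R \<bullet> e t" .
  have "\<Sigma> (u t) - \<Sigma> (u (t - h)) \<le> \<psi> t * (u t + u (t - h)) - (D t)\<^sup>2 / (2 * L)"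
    using \<Sigma>_cocoercive[of "u t" "- u (t - h)"] by (simp add: \<Sigma>_even odd D_def \<psi>_def)
  moreover have "\<psi> t * (R \<bullet> e t) \<le> \<bar>\<psi> t\<bar> * (h * (k1 * \<Psi> t))"
  proof -
    have "\<psi> t * (R \<bullet> e t) \<le> \<bar>\<psi> t\<bar> * \<bar>R \<bullet> e t\<bar>" by (metis abs_ge_self abs_mult)
    also have "\<dots> \<le> \<bar>\<psi> t\<bar> * (h * (k1 * \<Psi> t))"
      using inner_e_le[of R t] R by (intro mult_left_mono) auto
    finally show ?thesis .
  qed
  ultimately show ?thesis unfolding uu by (simp add: algebra_simps)
qed

lemma J_near:
  assumes "T > 2 * h" "T - h \<le> t" "t \<le> T"
  shows "norm (J T - J t) \<le> \<Delta> T"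
proof -
  have "norm (J T - J t) \<le> N T - N t"
    by (rule norm_diff_le_by_derivative[OF assms(3) J' N']) (use assms in auto)
  also have "\<dots> \<le> \<Delta> T" using N_mono[of "T - h" t] assms by (simp add: \<Delta>_def)
  finally show ?thesis .
qed

text \<open>From \<open>|\<psi> (t - h)| \<le> |\<psi> t| + |D t|\<close>, the sum
  \<open>N + \<Psi>\<close> is nondecreasing.\<close>

lemma \<Psi>_near:
  assumes "T > 2 * h" "T - h \<le> t" "t \<le> T"
  shows "\<Psi> t \<le> \<Psi> T + \<Delta> T"
proof -
  have "N t + \<Psi> t \<le> N T + \<Psi> T"
  proof (rule ge_by_derivative[OF assms(3)])
    fix s assume s: "t \<le> s" "s \<le> T"
    show "((\<lambda>t. N t + \<Psi> t) has_real_derivative \<bar>D s\<bar> + (\<bar>\<psi> s\<bar> - \<bar>\<psi> (s - h)\<bar>)) (at s)"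
      using s assms by (intro DERIV_add N' \<Psi>') auto
    show "0 \<le> \<bar>D s\<bar> + (\<bar>\<psi> s\<bar> - \<bar>\<psi> (s - h)\<bar>)"
      by (simp add: D_def)
  qed
  then show ?thesis using N_mono[of "T - h" t] assms by (simp add: \<Delta>_def)
qed

text \<open>\<open>V_rate\<close> is integrated over half a period after freezing \<open>J t\<close>
  at \<open>J T\<close> and bounding \<open>\<Psi> t\<close> by
  \<open>\<Psi> T + \<Delta> T\<close>. With \<open>J T\<close> fixed, the integral of
  \<open>\<psi> (J T \<bullet> e)\<close> is exactly the squared norm of \<open>J T\<close>.\<close>

lemma V_drop:
  assumes T: "T > 2 * h"
  shows "V T - V (T - h) \<le> - k2 * (norm (J T))\<^sup>2
    + (k2 * \<Delta> T + h * k1 * (\<Psi> T + \<Delta> T)) * \<Psi> T - (\<Delta> T)\<^sup>2 / (2 * L * h)"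
proof -
  define A where "A = k2 * \<Delta> T + h * k1 * (\<Psi> T + \<Delta> T)"
  \<comment> \<open>The mean of \<open>|D|\<close> over the window. Integrating the pointwise bound
    \<open>D^2 \<ge> 2 \<kappa> |D| - \<kappa>^2\<close> with this value yields the Cauchy-Schwarz
    bound for the integral of \<open>D^2\<close>.\<close>
  define \<kappa> where "\<kappa> = \<Delta> T / h"
  \<comment> \<open>\<open>V\<close> minus an antiderivative of the upper bound for its rate; the
    term in \<open>J T \<bullet> w\<close> is the antiderivative of
    \<open>k2 \<psi> (J T \<bullet> e)\<close>.\<close>
  define Y where "Y t = V t - k2 / k1 * (J T \<bullet> w t) - A * P t + \<kappa> / L * N t - \<kappa>\<^sup>2 / (2 * L) * t" for t
  define V1 where "V1 t = \<Sigma> (u t) - \<Sigma> (u (t - h)) - h * \<psi> t * (w t \<bullet> e t)" for t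
  have "Y T \<le> Y (T - h)"
  proof (rule le_by_derivative[where f = Y and f' = "\<lambda>t. V1 t - k2 / k1 * (J T \<bullet> (- (k1 * \<psi> t) *\<^sub>R e t) + 0 \<bullet> w t)
      - A * \<bar>\<psi> t\<bar> + \<kappa> / L * \<bar>D t\<bar> - \<kappa>\<^sup>2 / (2 * L) * 1"])
    fix t assume t: "T - h \<le> t" "t \<le> T"
    then have th: "t > h" "t > 0" using T h by auto
    then show "(Y has_real_derivative V1 t - k2 / k1 * (J T \<bullet> (- (k1 * \<psi> t) *\<^sub>R e t) + 0 \<bullet> w t)
      - A * \<bar>\<psi> t\<bar> + \<kappa> / L * \<bar>D t\<bar> - \<kappa>\<^sup>2 / (2 * L) * 1) (at t)"
      unfolding Y_def[abs_def] V1_def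
      by (intro DERIV_add DERIV_cmult DERIV_diff V' P' N' DERIV_ident
          has_vector_derivative_inner w' has_vector_derivative_const)
    have "V1 t \<le> - k2 * (\<psi> t * (J t \<bullet> e t)) + \<bar>\<psi> t\<bar> * (h * (k1 * \<Psi> t)) - (D t)\<^sup>2 / (2 * L)"
      unfolding V1_def by (rule V_rate[OF th(1)])
    moreover have "\<bar>\<psi> t\<bar> * (h * (k1 * \<Psi> t)) \<le> \<bar>\<psi> t\<bar> * (h * (k1 * (\<Psi> T + \<Delta> T)))"
      using \<Psi>_near[OF T t] h k1 by (intro mult_left_mono) auto
    moreover have "k2 * (\<psi> t * ((J T - J t) \<bullet> e t)) \<le> k2 * (\<bar>\<psi> t\<bar> * \<Delta> T)"
    proof -
      have "\<psi> t * ((J T - J t) \<bullet> e t) \<le> \<bar>\<psi> t\<bar> * \<bar>(J T - J t) \<bullet> e t\<bar>"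
        by (metis abs_ge_self abs_mult)
      also have "\<dots> \<le> \<bar>\<psi> t\<bar> * \<Delta> T"
        using inner_e_le[of "J T - J t" t] J_near[OF T t] by (intro mult_left_mono) auto
      finally show ?thesis using k2 by (intro mult_left_mono) auto
    qed
    moreover have "\<kappa> / L * \<bar>D t\<bar> - \<kappa>\<^sup>2 / (2 * L) - (D t)\<^sup>2 / (2 * L) \<le> 0"
    proof -
      have "\<kappa> / L * \<bar>D t\<bar> - \<kappa>\<^sup>2 / (2 * L) - (D t)\<^sup>2 / (2 * L) = - (\<bar>D t\<bar> - \<kappa>)\<^sup>2 / (2 * L)"
        using L by (simp add: field_simps power2_eq_square)
      then show ?thesis using L by simp
    qed
    moreover have "k2 / k1 * (J T \<bullet> (- (k1 * \<psi> t) *\<^sub>R e t) + 0 \<bullet> w t) = - k2 * (\<psi> t * (J T \<bullet> e t))"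
      using k1 by simp
    ultimately show "V1 t - k2 / k1 * (J T \<bullet> (- (k1 * \<psi> t) *\<^sub>R e t) + 0 \<bullet> w t)
      - A * \<bar>\<psi> t\<bar> + \<kappa> / L * \<bar>D t\<bar> - \<kappa>\<^sup>2 / (2 * L) * 1 \<le> 0"
      by (simp add: A_def inner_diff_left algebra_simps)
  qed (use h in auto)
  then have "V T - V (T - h) \<le> k2 / k1 * (J T \<bullet> (w T - w (T - h))) + A * \<Psi> T
      - \<kappa> / L * \<Delta> T + \<kappa>\<^sup>2 / (2 * L) * h"
    unfolding Y_def by (simp add: \<Psi>_def \<Delta>_def inner_diff_right algebra_simps diff_divide_distrib)
  also have "k2 / k1 * (J T \<bullet> (w T - w (T - h))) = - k2 * (norm (J T))\<^sup>2"
    unfolding w_J using k1 by (simp add: power2_norm_eq_inner)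
  also have "- k2 * (norm (J T))\<^sup>2 + A * \<Psi> T - \<kappa> / L * \<Delta> T + \<kappa>\<^sup>2 / (2 * L) * h
    = - k2 * (norm (J T))\<^sup>2 + A * \<Psi> T - (\<Delta> T)\<^sup>2 / (2 * L * h)"
    using h L by (simp add: \<kappa>_def field_simps power2_eq_square)
  finally show ?thesis unfolding A_def .
qed

section \<open>Comparison with a frozen state\<close>

definition Ptot :: "real \<Rightarrow> real" where "Ptot T = P T - P (T - 2 * h)"

lemma Ptot_eq: "Ptot T = \<Psi> T + \<Psi> (T - h)"
  by (simp add: Ptot_def \<Psi>_def)

lemma Ptot_le: "T > 2 * h \<Longrightarrow> Ptot T \<le> 2 * \<Psi> T + \<Delta> T"
  using \<Psi>_near[of T "T - h"] h by (simp add: Ptot_eq)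

lemma \<Delta>_le: "T > 2 * h \<Longrightarrow> \<Delta> T \<le> Ptot T"
proof -
  assume T: "T > 2 * h"
  have "N T - P T - P (T - h) \<le> N (T - h) - P (T - h) - P (T - h - h)"
  proof (rule le_by_derivative[where f = "\<lambda>t. N t - P t - P (t - h)" and f' = "\<lambda>t. \<bar>D t\<bar> - \<bar>\<psi> t\<bar> - \<bar>\<psi> (t - h)\<bar>"])
    fix t assume t: "T - h \<le> t" "t \<le> T"
    show "((\<lambda>t. N t - P t - P (t - h)) has_real_derivative \<bar>D t\<bar> - \<bar>\<psi> t\<bar> - \<bar>\<psi> (t - h)\<bar>) (at t)"
      using t T h by (intro DERIV_diff N' P' has_real_derivative_shift) auto
    show "\<bar>D t\<bar> - \<bar>\<psi> t\<bar> - \<bar>\<psi> (t - h)\<bar> \<le> 0" by (simp add: D_def)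
  qed (use h in simp)
  then show "\<Delta> T \<le> Ptot T" by (simp add: \<Delta>_def Ptot_def algebra_simps)
qed

text \<open>Bounds the \<open>v_drift\<close> error on every window of length at most
  \<open>h\<close> inside \<open>[T - 2h, T]\<close> that starts or ends at
  \<open>T - h\<close>.\<close>

definition E :: "real \<Rightarrow> real" where "E T = (k2 + h * k1) * Ptot T"

lemma Ptot_nonneg: "T > 2 * h \<Longrightarrow> 0 \<le> Ptot T"
  using \<Psi>_nonneg[of T] \<Psi>_nonneg[of "T - h"] h by (simp add: Ptot_eq)

lemma E_nonneg: "T > 2 * h \<Longrightarrow> 0 \<le> E T"
  using Ptot_nonneg[of T] k1 k2 h by (simp add: E_def)

text \<open>
  Freezing \<open>v\<close> at time \<open>T - h\<close> costs only the antiperiodicity defect of \<open>\<psi>\<close>: up to the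
  error \<open>E\<close>, the frozen input at time \<open>s\<close> lies between \<open>u s\<close> and \<open>- u (s - h)\<close>.
\<close>

lemma frozen_input:
  assumes T: "T > 2 * h" and s: "T - h \<le> s" "s \<le> T"
  shows "\<bar>\<psi> s - \<sigma> (v (T - h) \<bullet> e s)\<bar> \<le> \<bar>D s\<bar> + L * E T"
proof -
  define a where "a = v (T - h) \<bullet> e s"
  define c where "c = w (T - h) \<bullet> e s"
  have P1: "P s - P (T - h) \<le> Ptot T" "P (T - h) - P (s - h) \<le> Ptot T"
    "0 \<le> P s - P (T - h)" "0 \<le> P (T - h) - P (s - h)"
    unfolding Ptot_def
    using P_mono[of s T] P_mono[of "T - 2 * h" "T - h"] P_mono[of "T - h" T]
      P_mono[of "T - 2 * h" "s - h"] P_mono[of "T - h" s] P_mono[of "s - h" "T - h"] T s h by auto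
  have "norm (v s - v (T - h) - (s - (T - h)) *\<^sub>R w (T - h)) \<le> (k2 + (s - (T - h)) * k1) * (P s - P (T - h))"
    using v_drift[of "T - h" "T - h" s] T s h by simp
  also have "\<dots> \<le> E T"
    unfolding E_def using P1 s k1 k2 h by (intro mult_mono add_mono mult_right_mono) auto
  finally have 1: "norm (v s - v (T - h) - (s - (T - h)) *\<^sub>R w (T - h)) \<le> E T" .
  have "norm (v (T - h) - v (s - h) - ((T - h) - (s - h)) *\<^sub>R w (T - h))
      \<le> (k2 + ((T - h) - (s - h)) * k1) * (P (T - h) - P (s - h))"
    using v_drift[of "s - h" "T - h" "T - h"] T s h by simp
  also have "\<dots> \<le> E T"
    unfolding E_def using P1 s k1 k2 h by (intro mult_mono add_mono mult_right_mono) auto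
  finally have 2: "norm (v (T - h) - v (s - h) - (T - s) *\<^sub>R w (T - h)) \<le> E T" by simp
  have u1: "\<bar>u s - a - (s - (T - h)) * c\<bar> \<le> E T"
    using order_trans[OF inner_e_le 1, of s] by (simp add: u_def a_def c_def inner_diff_left)
  have "u (s - h) = - (v (s - h) \<bullet> e s)" by (simp add: u_def)
  then have u2: "\<bar>a + u (s - h) - (T - s) * c\<bar> \<le> E T"
    using order_trans[OF inner_e_le 2, of s] by (simp add: a_def c_def inner_diff_left)
  have shift: "\<sigma> (x + E T) \<le> \<sigma> x + L * E T" "\<sigma> x - L * E T \<le> \<sigma> (x - E T)" for x
    using lip[of "x + E T" x] lip[of x "x - E T"] E_nonneg[OF T] by auto
  have D: "\<sigma> (- u (s - h)) = \<psi> s - D s" "\<sigma> (u s) = \<psi> s"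
    by (simp_all add: odd D_def \<psi>_def)
  \<comment> \<open>Up to \<open>E T\<close>, \<open>u s\<close> is
    \<open>a + (s - (T - h)) * c\<close> and \<open>- u (s - h)\<close> is
    \<open>a - (T - s) * c\<close>. These displacements have opposite signs, so \<open>a\<close>
    lies between the two inputs in an order set by the sign of \<open>c\<close>; monotonicity
    transfers this to \<open>\<psi> s\<close> and \<open>\<psi> s - D s\<close>.\<close>
  show ?thesis
  proof (cases "c \<ge> 0")
    case True
    then have "0 \<le> (s - (T - h)) * c" "0 \<le> (T - s) * c" using s by auto
    then have "a \<le> u s + E T" "- u (s - h) - E T \<le> a" using u1 u2 by auto
    then have "\<sigma> a \<le> \<sigma> (u s + E T)" "\<sigma> (- u (s - h) - E T) \<le> \<sigma> a" by (auto intro: monoD[OF mono])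
    then show ?thesis using shift(1)[of "u s"] shift(2)[of "- u (s - h)"] D E_nonneg[OF T] L
      unfolding a_def[symmetric] by auto
  next
    case False
    then have "(s - (T - h)) * c \<le> 0" "(T - s) * c \<le> 0" using s by (auto simp: mult_nonneg_nonpos)
    then have "u s - E T \<le> a" "a \<le> - u (s - h) + E T" using u1 u2 by auto
    then have "\<sigma> (u s - E T) \<le> \<sigma> a" "\<sigma> a \<le> \<sigma> (- u (s - h) + E T)" by (auto intro: monoD[OF mono])
    then show ?thesis using shift(2)[of "u s"] shift(1)[of "- u (s - h)"] D E_nonneg[OF T] L
      unfolding a_def[symmetric] by auto
  qed
qed

text \<open>Oddness absorbs the sign of the cosine, so \<open>scale\<close> applies with the factor
  \<open>|cos x|\<close>. The first harmonic of a saturated cosine thereby stays comparable to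
  \<open>\<sigma> r\<close> at every amplitude.\<close>

lemma \<sigma>_cos: "0 \<le> r \<Longrightarrow> \<gamma> * \<sigma> r * (cos x)\<^sup>2 \<le> \<sigma> (r * cos x) * cos x"
proof (cases "cos x \<ge> 0")
  case True
  assume r: "0 \<le> r"
  have "\<gamma> * cos x * \<sigma> r * cos x \<le> \<sigma> (cos x * r) * cos x"
    using scale[OF r True] True by (intro mult_right_mono) auto
  then show ?thesis by (simp add: power2_eq_square mult_ac)
next
  case False
  assume r: "0 \<le> r"
  have "\<gamma> * (- cos x) * \<sigma> r * (- cos x) \<le> \<sigma> ((- cos x) * r) * (- cos x)"
    using scale[OF r, of "- cos x"] False by (intro mult_right_mono) auto
  then show ?thesis by (simp add: power2_eq_square mult_ac odd)
qed

lemma J_lower: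
  assumes T: "T > 2 * h"
  shows "\<gamma> * h / 2 * \<sigma> (norm (v (T - h))) \<le> norm (J T) + \<Delta> T + h * (L * E T)"
proof -
  define r where "r = norm (v (T - h))"
  define \<phi> where "\<phi> = Arg (v (T - h))"
  have p: "v (T - h) = r *\<^sub>R cis \<phi>"
    using rcis_cmod_Arg[of "v (T - h)"] by (simp add: r_def \<phi>_def rcis_def scaleR_conv_of_real)
  have ce: "cis \<phi> \<bullet> e s = cos (\<omega> * s + \<phi>)" for s
    by (simp add: e_def inner_complex_def cos_add)
  \<comment> \<open>The bracket is a primitive of the squared cosine, and the \<open>w\<close> term
    has derivative \<open>\<psi> s * cos (\<omega> * s + \<phi>)\<close>.\<close>
  define Z where "Z s = - (1 / k1) * (cis \<phi> \<bullet> w s)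
      - \<gamma> * \<sigma> r * (s / 2 + sin (2 * (\<omega> * s + \<phi>)) / (4 * \<omega>)) + N s + L * E T * s" for s
  have "Z (T - h) \<le> Z T"
  proof (rule ge_by_derivative[where f = Z and f' = "\<lambda>s. - (1 / k1) * (cis \<phi> \<bullet> (- (k1 * \<psi> s) *\<^sub>R e s) + 0 \<bullet> w s)
      - \<gamma> * \<sigma> r * (cos (\<omega> * s + \<phi>))\<^sup>2 + \<bar>D s\<bar> + L * E T * 1"])
    fix s assume s: "T - h \<le> s" "s \<le> T"
    then have sh: "s > h" "s > 0" using T h by auto
    have "((\<lambda>s. s / 2 + sin (2 * (\<omega> * s + \<phi>)) / (4 * \<omega>)) has_real_derivative
        1 / 2 + cos (2 * (\<omega> * s + \<phi>)) / 2) (at s)"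
      using \<omega> by (auto intro!: derivative_eq_intros)
    moreover have "1 / 2 + cos (2 * (\<omega> * s + \<phi>)) / 2 = (cos (\<omega> * s + \<phi>))\<^sup>2"
      unfolding cos_double_cos by (simp add: field_simps)
    ultimately have "((\<lambda>s. s / 2 + sin (2 * (\<omega> * s + \<phi>)) / (4 * \<omega>)) has_real_derivative
        (cos (\<omega> * s + \<phi>))\<^sup>2) (at s)" by simp
    then show "(Z has_real_derivative - (1 / k1) * (cis \<phi> \<bullet> (- (k1 * \<psi> s) *\<^sub>R e s) + 0 \<bullet> w s)
      - \<gamma> * \<sigma> r * (cos (\<omega> * s + \<phi>))\<^sup>2 + \<bar>D s\<bar> + L * E T * 1) (at s)"
      unfolding Z_def[abs_def] using sh
      by (intro DERIV_add DERIV_cmult DERIV_diff N' DERIV_ident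
          has_vector_derivative_inner w' has_vector_derivative_const)
    define c where "c = cos (\<omega> * s + \<phi>)"
    have ps: "v (T - h) \<bullet> e s = r * c" by (simp add: p ce c_def)
    have "\<gamma> * \<sigma> r * c\<^sup>2 \<le> \<sigma> (r * c) * c" unfolding c_def by (rule \<sigma>_cos) (simp add: r_def)
    moreover have "(\<sigma> (r * c) - \<psi> s) * c \<le> \<bar>D s\<bar> + L * E T"
    proof -
      have "(\<sigma> (r * c) - \<psi> s) * c \<le> \<bar>\<sigma> (r * c) - \<psi> s\<bar> * \<bar>c\<bar>" by (metis abs_ge_self abs_mult)
      also have "\<dots> \<le> (\<bar>D s\<bar> + L * E T) * 1"
        using frozen_input[OF T s] E_nonneg[OF T] L unfolding ps
        by (intro mult_mono) (auto simp: c_def abs_minus_commute)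
      finally show ?thesis by simp
    qed
    ultimately have "0 \<le> \<psi> s * c - \<gamma> * \<sigma> r * c\<^sup>2 + \<bar>D s\<bar> + L * E T"
      by (simp add: algebra_simps)
    then show "0 \<le> - (1 / k1) * (cis \<phi> \<bullet> (- (k1 * \<psi> s) *\<^sub>R e s) + 0 \<bullet> w s)
      - \<gamma> * \<sigma> r * (cos (\<omega> * s + \<phi>))\<^sup>2 + \<bar>D s\<bar> + L * E T * 1"
      using k1 by (simp add: ce c_def)
  qed (use h in simp)
  \<comment> \<open>Doubling the angle turns the half period into a full one, so the oscillating
    part of the primitive drops out.\<close>
  moreover have "sin (2 * (\<omega> * (T - h) + \<phi>)) = sin (2 * (\<omega> * T + \<phi>))"
  proof -
    have "2 * (\<omega> * (T - h) + \<phi>) = 2 * (\<omega> * T + \<phi>) - 2 * pi"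
      using \<omega> by (simp add: h_def algebra_simps)
    then show ?thesis by (simp only: sin_diff) simp
  qed
  ultimately have "\<gamma> * \<sigma> r * (h / 2) \<le> - (1 / k1) * (cis \<phi> \<bullet> (w T - w (T - h))) + \<Delta> T + h * (L * E T)"
    by (simp add: Z_def \<Delta>_def inner_diff_right algebra_simps add_divide_distrib diff_divide_distrib)
  moreover have "- (1 / k1) * (cis \<phi> \<bullet> (w T - w (T - h))) = cis \<phi> \<bullet> J T"
    unfolding w_J using k1 by simp
  moreover have "cis \<phi> \<bullet> J T \<le> norm (J T)"
    using norm_cauchy_schwarz[of "cis \<phi>" "J T"] by simp
  ultimately show ?thesis unfolding r_def[symmetric] by (simp add: mult_ac)
qed

lemma \<Psi>_upper:
  assumes T: "T > 2 * h"
  shows "\<Psi> T \<le> h * \<sigma> (norm (v (T - h))) + \<Delta> T + h * (L * E T)"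
proof -
  define r where "r = norm (v (T - h))"
  have "P T - N T - (\<sigma> r + L * E T) * T \<le> P (T - h) - N (T - h) - (\<sigma> r + L * E T) * (T - h)"
  proof (rule le_by_derivative[where f = "\<lambda>s. P s - N s - (\<sigma> r + L * E T) * s"
        and f' = "\<lambda>s. \<bar>\<psi> s\<bar> - \<bar>D s\<bar> - (\<sigma> r + L * E T) * 1"])
    fix s assume s: "T - h \<le> s" "s \<le> T"
    then have sh: "s > h" "s > 0" using T h by auto
    then show "((\<lambda>s. P s - N s - (\<sigma> r + L * E T) * s) has_real_derivative
        \<bar>\<psi> s\<bar> - \<bar>D s\<bar> - (\<sigma> r + L * E T) * 1) (at s)"
      by (intro DERIV_diff P' N' DERIV_cmult DERIV_ident)
    have "\<bar>v (T - h) \<bullet> e s\<bar> \<le> r" unfolding r_def by (rule inner_e_le)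
    then have "\<bar>\<sigma> (v (T - h) \<bullet> e s)\<bar> \<le> \<sigma> r"
      using monoD[OF mono, of "v (T - h) \<bullet> e s" r] monoD[OF mono, of "- r" "v (T - h) \<bullet> e s"]
      by (auto simp: odd abs_le_iff)
    then show "\<bar>\<psi> s\<bar> - \<bar>D s\<bar> - (\<sigma> r + L * E T) * 1 \<le> 0"
      using frozen_input[OF T s] by auto
  qed (use h in simp)
  then show ?thesis unfolding r_def[symmetric] by (simp add: \<Psi>_def \<Delta>_def algebra_simps)
qed

lemma J_upper: "T > h \<Longrightarrow> norm (J T) \<le> \<Psi> T"
  using w_diff[of "T - h" T] h k1 by (simp add: w_J \<Psi>_def)

end

section \<open>Stability in the rotating frame\<close>

context slow_saturated_feedback
begin

text \<open>A control effort per period below which the state is smaller than \<open>\<eta>\<close>.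
  The first entry bounds \<open>v\<close> through \<open>J_lower\<close>, the second bounds the
  \<open>v_drift\<close> error; the thirds arise because \<open>h w\<close> is recovered from two
  values of \<open>v\<close> and that error.\<close>

definition tol :: "real \<Rightarrow> real" where
  "tol \<eta> = min (\<gamma> * h * (m * min (min \<eta> (h * \<eta> / 3)) 1) / 6) (h * \<eta> / (3 * (k2 + h * k1)))"

text \<open>What is left of the coefficient \<open>k2 * \<gamma>^2 / 32\<close> when the cross terms
  take \<open>1 / 64\<close> and the term in \<open>h * k1\<close> takes
  \<open>1 / 128\<close>.\<close>

definition rate :: real where "rate = k2 * \<gamma>\<^sup>2 / 128"

text \<open>If the state is bounded by \<open>B\<close> on the first two half periods, the effort
  over any later full period is at most \<open>gain * B\<close>. The root bounds
  \<open>\<Psi>\<close> through \<open>V\<close>, the summand \<open>h * L\<close> covers the first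
  window directly, and the factor 2 counts the half periods in \<open>Ptot\<close>.\<close>

definition gain :: real where
  "gain = 2 * (sqrt ((h * (L / 2) + h / (2 * k1)) / rate) + h * L)"

lemma rate_pos: "rate > 0" using k2 \<gamma> by (simp add: rate_def)

lemma tol_pos: "\<eta> > 0 \<Longrightarrow> tol \<eta> > 0"
  using \<gamma> h m k1 k2 by (auto simp: tol_def intro!: mult_pos_pos divide_pos_pos add_pos_pos)

lemma gain_pos: "gain > 0"
  using rate_pos h L k1 by (auto simp: gain_def intro!: add_nonneg_pos)

end

context slow_trajectory
begin

section \<open>Strict decrease and control of the state by the effort\<close>

lemma E_small:
  assumes "T > 2 * h"
  shows "h * (L * E T) \<le> \<gamma> / 16 * Ptot T"
proof -
  have "16 * (h * L * (k2 + h * k1)) \<le> \<gamma>" using slow1 by (simp only: mult.assoc)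
  then have "h * L * (k2 + h * k1) \<le> \<gamma> / 16" by linarith
  from mult_right_mono[OF this Ptot_nonneg[OF assms]] show ?thesis
    by (simp only: E_def mult.assoc)
qed

text \<open>Eliminates \<open>\<sigma> (norm (v (T - h)))\<close> between \<open>J_lower\<close> and
  \<open>\<Psi>_upper\<close>. The freezing error is absorbed by \<open>E_small\<close>, since a
  full period of effort is at most \<open>2 * \<Psi> T + \<Delta> T\<close>.\<close>

lemma J_lower':
  assumes T: "T > 2 * h"
  shows "\<gamma> / 4 * \<Psi> T \<le> norm (J T) + 3 * \<Delta> T"
proof -
  define s where "s = h * \<sigma> (norm (v (T - h)))"
  define q where "q = h * (L * E T)"
  have 1: "\<gamma> / 2 * s \<le> norm (J T) + \<Delta> T + q"
    using J_lower[OF T] by (simp add: s_def q_def mult_ac)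
  have 2: "\<Psi> T \<le> s + \<Delta> T + q" using \<Psi>_upper[OF T] by (simp add: s_def q_def)
  have q0: "0 \<le> q" using E_nonneg[OF T] h L by (simp add: q_def)
  have "q \<le> \<gamma> / 16 * (2 * \<Psi> T + \<Delta> T)"
    unfolding q_def using \<gamma> by (intro order_trans[OF E_small[OF T]] mult_left_mono Ptot_le[OF T]) auto
  moreover have "\<gamma> * \<Delta> T \<le> \<Delta> T" using \<gamma> \<Delta>_nonneg[OF T] by (simp add: mult_left_le_one_le)
  ultimately have 3: "q \<le> \<gamma> / 8 * \<Psi> T + \<Delta> T / 16" by (simp add: algebra_simps)
  have "\<gamma> / 2 * \<Psi> T \<le> \<gamma> / 2 * (s + \<Delta> T + q)" using 2 \<gamma> by (intro mult_left_mono) auto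
  also have "\<dots> \<le> \<gamma> / 2 * s + (\<Delta> T + q) / 2"
    using \<gamma> \<Delta>_nonneg[OF T] q0 mult_right_mono[of \<gamma> 1 "\<Delta> T + q"] by (simp add: algebra_simps)
  also have "\<dots> \<le> norm (J T) + 3 / 2 * \<Delta> T + 3 / 2 * q" using 1 by argo
  also have "\<dots> \<le> norm (J T) + 3 / 2 * \<Delta> T + 3 / 2 * (\<gamma> / 8 * \<Psi> T + \<Delta> T / 16)" using 3 by simp
  finally have *: "\<gamma> / 2 * \<Psi> T \<le> \<dots>" .
  have nn: "0 \<le> \<gamma> * \<Psi> T" using \<gamma> \<Psi>_nonneg[of T] T h by simp
  show ?thesis
    using * nn \<Delta>_nonneg[OF T] norm_ge_zero[of "J T"] by argo
qed

text \<open>The square of \<open>J_lower'\<close> converts the dissipation in \<open>J\<close> into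
  one in \<open>\<Psi>\<close>, at the price of \<open>9 * k2\<close> times the squared defect. The
  dissipation in the defect pays for this and for the cross terms by \<open>slow3\<close>;
  \<open>slow2\<close> handles the term \<open>h * k1\<close> times the squared
  \<open>\<Psi>\<close>.\<close>

lemma V_decrease:
  assumes T: "T > 2 * h"
  shows "V T \<le> V (T - h) - rate * (\<Psi> T)\<^sup>2"
proof -
  define a d j where "a = \<Psi> T" and "d = \<Delta> T" and "j = norm (J T)"
  have a: "0 \<le> a" using \<Psi>_nonneg[of T] T h by (simp add: a_def)
  have d: "0 \<le> d" using \<Delta>_nonneg[OF T] by (simp add: d_def)
  have "(\<gamma> / 4 * a)\<^sup>2 \<le> (j + 3 * d)\<^sup>2"
    using J_lower'[OF T] \<gamma> a by (intro power_mono) (auto simp: a_def d_def j_def)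
  also have "\<dots> \<le> 2 * j\<^sup>2 + 18 * d\<^sup>2"
    using zero_le_power2[of "j - 3 * d"] by (simp add: power2_eq_square algebra_simps)
  finally have "\<gamma>\<^sup>2 * a\<^sup>2 / 32 - 9 * d\<^sup>2 \<le> j\<^sup>2" by (simp add: power_mult_distrib power_divide)
  then have 1: "k2 * (\<gamma>\<^sup>2 * a\<^sup>2 / 32 - 9 * d\<^sup>2) \<le> k2 * j\<^sup>2" using k2 by (intro mult_left_mono) auto
  have "\<gamma>\<^sup>2 \<le> 1" using \<gamma> by (simp add: power_le_one)
  then have "k2 * \<gamma>\<^sup>2 \<le> k2" using k2 by simp
  then have hk: "h * k1 \<le> k2" using slow2 mult_pos_pos[OF h k1] by linarith
  \<comment> \<open>Young's inequality with weights \<open>\<gamma> / 8\<close> and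
    \<open>8 / \<gamma>\<close>: the part in \<open>a\<close> uses up only half of the available
    \<open>\<gamma>^2 / 32\<close>.\<close>
  have "2 * (d * a) \<le> \<gamma>\<^sup>2 / 64 * a\<^sup>2 + 64 / \<gamma>\<^sup>2 * d\<^sup>2"
  proof -
    have "2 * (\<gamma> / 8 * a) * (8 / \<gamma> * d) \<le> (\<gamma> / 8 * a)\<^sup>2 + (8 / \<gamma> * d)\<^sup>2"
      by (rule sum_squares_bound)
    moreover have "2 * (\<gamma> / 8 * a) * (8 / \<gamma> * d) = 2 * (d * a)" using \<gamma> by simp
    ultimately show ?thesis by (simp only: power_mult_distrib power_divide) simp
  qed
  then have "k2 * (2 * (d * a)) \<le> k2 * (\<gamma>\<^sup>2 / 64 * a\<^sup>2 + 64 / \<gamma>\<^sup>2 * d\<^sup>2)"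
    using k2 by (intro mult_left_mono) auto
  moreover have "h * k1 * (d * a) \<le> k2 * (d * a)" using hk a d by (intro mult_right_mono) auto
  ultimately have 2: "k2 * (d * a) + h * k1 * (d * a) \<le> k2 * (\<gamma>\<^sup>2 / 64 * a\<^sup>2 + 64 / \<gamma>\<^sup>2 * d\<^sup>2)"
    by simp
  have 3: "h * k1 * a\<^sup>2 \<le> k2 * \<gamma>\<^sup>2 / 128 * a\<^sup>2" using slow2 by (intro mult_right_mono) auto
  have "k2 * (9 + 64 / \<gamma>\<^sup>2) \<le> 1 / (2 * L * h)"
    using slow3 L h by (simp add: pos_le_divide_eq mult_ac)
  then have 4: "k2 * (9 + 64 / \<gamma>\<^sup>2) * d\<^sup>2 \<le> d\<^sup>2 / (2 * L * h)"
    using mult_right_mono[of "k2 * (9 + 64 / \<gamma>\<^sup>2)" "1 / (2 * L * h)" "d\<^sup>2"] by simp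
  have "V T - V (T - h) \<le> - k2 * j\<^sup>2 + (k2 * (d * a) + h * k1 * (d * a)) + h * k1 * a\<^sup>2 - d\<^sup>2 / (2 * L * h)"
    using V_drop[OF T] unfolding a_def[symmetric] d_def[symmetric] j_def[symmetric]
    by (simp add: algebra_simps power2_eq_square)
  also have "\<dots> \<le> - (k2 * (\<gamma>\<^sup>2 * a\<^sup>2 / 32 - 9 * d\<^sup>2)) + k2 * (\<gamma>\<^sup>2 / 64 * a\<^sup>2 + 64 / \<gamma>\<^sup>2 * d\<^sup>2)
      + k2 * \<gamma>\<^sup>2 / 128 * a\<^sup>2 - k2 * (9 + 64 / \<gamma>\<^sup>2) * d\<^sup>2"
    using 1 2 3 4 by simp
  also have "\<dots> = - rate * a\<^sup>2" by (simp add: rate_def algebra_simps)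
  finally show ?thesis by (simp add: a_def)
qed

text \<open>Small effort around \<open>T\<close> and around \<open>T + h\<close> makes
  \<open>v\<close> small at \<open>T - h\<close> and at \<open>T\<close> by \<open>J_lower\<close>.
  By \<open>v_drift\<close> the increment of \<open>v\<close> between these times is nearly
  \<open>h *\<close> the value of \<open>w\<close> at \<open>T - h\<close>, so \<open>w\<close> is
  small too.\<close>

lemma state_small:
  assumes T: "T > 2 * h" and P: "Ptot T < tol \<eta>" "Ptot (T + h) < tol \<eta>" and \<eta>: "\<eta> > 0"
  shows "norm (v (T - h)) < \<eta>" "norm (w (T - h)) < \<eta>"
proof -
  define r where "r = min \<eta> (h * \<eta> / 3)"
  have r: "norm (v (t - h)) < r" if t: "t > 2 * h" "Ptot t < tol \<eta>" for t
  proof (rule ccontr)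
    assume "\<not> norm (v (t - h)) < r"
    then have "m * min r 1 \<le> m * min (norm (v (t - h))) 1" using m by (intro mult_left_mono) auto
    also have "\<dots> \<le> \<sigma> (norm (v (t - h)))" by (rule lower) simp
    finally have "\<gamma> * h * (m * min r 1) \<le> \<gamma> * h * \<sigma> (norm (v (t - h)))"
      using \<gamma> h by (intro mult_left_mono) auto
    also have "\<dots> \<le> 2 * (norm (J t) + \<Delta> t + h * (L * E t))" using J_lower[OF t(1)] by simp
    also have "\<dots> \<le> 6 * Ptot t"
    proof -
      have "norm (J t) \<le> Ptot t"
        using J_upper[of t] \<Psi>_nonneg[of "t - h"] t h by (simp add: Ptot_eq)
      moreover have "\<gamma> / 16 * Ptot t \<le> Ptot t"
        using \<gamma> Ptot_nonneg[OF t(1)] by (intro mult_left_le_one_le) auto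
      ultimately show ?thesis using E_small[OF t(1)] \<Delta>_le[OF t(1)] by simp
    qed
    also have "\<dots> < 6 * tol \<eta>" using t by simp
    also have "\<dots> \<le> 6 * (\<gamma> * h * (m * min r 1) / 6)"
      unfolding tol_def r_def by (intro mult_left_mono min.cobounded1) simp
    finally show False by simp
  qed
  have vT: "norm (v (T - h)) < r" by (rule r[OF T P(1)])
  have vTh: "norm (v T) < r" using r[of "T + h"] T P h by simp
  show "norm (v (T - h)) < \<eta>" using vT by (simp add: r_def)
  have "norm (v T - v (T - h) - h *\<^sub>R w (T - h)) \<le> (k2 + h * k1) * \<Psi> T"
    using v_drift[of "T - h" "T - h" T] T h by (simp add: \<Psi>_def)
  also have "\<dots> \<le> (k2 + h * k1) * Ptot T"
    using \<Psi>_nonneg[of "T - h"] T h k1 k2 by (intro mult_left_mono) (auto simp: Ptot_eq)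
  also have "\<dots> < (k2 + h * k1) * tol \<eta>"
    using P k1 k2 h by (intro mult_strict_left_mono) (auto intro: add_pos_pos)
  also have "\<dots> \<le> (k2 + h * k1) * (h * \<eta> / (3 * (k2 + h * k1)))"
    using k1 k2 h by (intro mult_left_mono) (auto simp: tol_def)
  also have "\<dots> = h * \<eta> / 3"
  proof -
    have "k2 + h * k1 > 0" using k1 k2 h by (simp add: add_pos_pos)
    then show ?thesis by (simp add: field_simps)
  qed
  finally have "norm (v T - v (T - h) - h *\<^sub>R w (T - h)) < h * \<eta> / 3" .
  moreover have "norm (h *\<^sub>R w (T - h)) \<le> norm (v T) + norm (v (T - h)) + norm (v T - v (T - h) - h *\<^sub>R w (T - h))"
    using norm_triangle_ineq4[of "v T - v (T - h)" "v T - v (T - h) - h *\<^sub>R w (T - h)"]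
      norm_triangle_ineq4[of "v T" "v (T - h)"] by simp
  moreover have "norm (v T) < h * \<eta> / 3" "norm (v (T - h)) < h * \<eta> / 3"
    using vT vTh by (auto simp: r_def)
  ultimately have "norm (h *\<^sub>R w (T - h)) < h * \<eta>" by simp
  then show "norm (w (T - h)) < \<eta>" using h by simp
qed

section \<open>Boundedness and convergence of trajectories\<close>

lemma \<psi>_le: "\<bar>\<psi> t\<bar> \<le> L * norm (v t)"
proof -
  have "\<bar>\<psi> t\<bar> \<le> L * \<bar>u t\<bar>" using lip[of "u t" 0] by (simp add: \<psi>_def)
  also have "\<dots> \<le> L * norm (v t)" using inner_e_le L by (simp add: u_def)
  finally show ?thesis .
qed

text \<open>The initial bound gives \<open>V \<le> C * B^2\<close> on the first window, and
  \<open>V_decrease\<close> preserves it. As \<open>V\<close> is nonnegative, each decrement is at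
  most \<open>V\<close>, so \<open>\<Psi>\<close> is bounded by a multiple of \<open>B\<close> for
  all time and \<open>state_small\<close> applies.\<close>

lemma bounded_by_initial_window:
  assumes B: "\<And>t. 0 < t \<Longrightarrow> t \<le> 2 * h \<Longrightarrow> norm (v t) \<le> B \<and> norm (w t) \<le> B"
    and small: "gain * B < tol \<eta>" and \<eta>: "\<eta> > 0" and t: "t > h"
  shows "norm (v t) < \<eta>" "norm (w t) < \<eta>"
proof -
  define C where "C = h * (L / 2) + h / (2 * k1)"
  have C: "C > 0" using h L k1 by (simp add: C_def add_pos_pos)
  have gain: "gain / 2 = sqrt (C / rate) + h * L" by (simp add: gain_def C_def)
  have C_rate: "0 \<le> sqrt (C / rate)" using C rate_pos by simp
  have B0: "0 \<le> B" using order_trans[OF norm_ge_zero, of "v h" B] B[of h] h by simp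
  have V0: "V T \<le> C * B\<^sup>2" if T: "h < T" "T \<le> 2 * h" for T
  proof -
    have "S T - (L / 2 * B\<^sup>2) * T \<le> S (T - h) - (L / 2 * B\<^sup>2) * (T - h)"
    proof (rule le_by_derivative[where f = "\<lambda>s. S s - (L / 2 * B\<^sup>2) * s" and f' = "\<lambda>s. \<Sigma> (u s) - (L / 2 * B\<^sup>2) * 1"])
      fix s assume s: "T - h \<le> s" "s \<le> T"
      then show "((\<lambda>s. S s - (L / 2 * B\<^sup>2) * s) has_real_derivative \<Sigma> (u s) - (L / 2 * B\<^sup>2) * 1) (at s)"
        using T by (intro DERIV_diff S' DERIV_cmult DERIV_ident) auto
      have "\<bar>u s\<bar> \<le> B" using inner_e_le[of "v s" s] B[of s] s T by (auto simp: u_def)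
      then have "(u s)\<^sup>2 \<le> B\<^sup>2" using power_mono[of "\<bar>u s\<bar>" B 2] by simp
      then have "L / 2 * (u s)\<^sup>2 \<le> L / 2 * B\<^sup>2" using L by (intro mult_left_mono) auto
      then show "\<Sigma> (u s) - (L / 2 * B\<^sup>2) * 1 \<le> 0" using \<Sigma>_le[of "u s"] by simp
    qed (use h in simp)
    then have "S T - S (T - h) \<le> h * (L / 2) * B\<^sup>2" by (simp add: algebra_simps diff_divide_distrib)
    moreover have "h / (2 * k1) * (w T \<bullet> w T) \<le> h / (2 * k1) * B\<^sup>2"
    proof -
      have "norm (w T) \<le> B" using B[of T] T h by simp
      then have "w T \<bullet> w T \<le> B\<^sup>2" by (simp add: power_mono flip: power2_norm_eq_inner)
      then show ?thesis using h k1 by (intro mult_left_mono) auto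
    qed
    ultimately show ?thesis by (simp add: V_def C_def algebra_simps)
  qed
  have V: "V T \<le> C * B\<^sup>2" if "h < T" for T
  proof -
    \<comment> \<open>\<open>V_decrease\<close> compares only times that are \<open>h\<close> apart,
      so the bound is propagated one half period at a time from the window between \<open>h\<close>
      and \<open>2 * h\<close>, which is the case \<open>n = 0\<close>.\<close>
    have "\<forall>T. h < T \<and> T \<le> real (n + 2) * h \<longrightarrow> V T \<le> C * B\<^sup>2" for n
    proof (induction n)
      case (Suc n)
      show ?case
      proof (intro allI impI)
        fix T assume T: "h < T \<and> T \<le> real (Suc n + 2) * h"
        show "V T \<le> C * B\<^sup>2"
        proof (cases "T \<le> 2 * h")
          case False
          then have "V T \<le> V (T - h)"
            using V_decrease[of T] rate_pos by (smt (verit) mult_nonneg_nonneg zero_le_power2)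
          also have "\<dots> \<le> C * B\<^sup>2" using Suc T False by (simp add: algebra_simps)
          finally show ?thesis .
        qed (use T V0 in auto)
      qed
    qed (use V0 in auto)
    moreover obtain n where "T / h \<le> real n" using real_arch_simple by blast
    then have "T \<le> real (n + 2) * h" using h by (simp add: field_simps)
    ultimately show ?thesis using that by blast
  qed
  have \<Psi>B: "\<Psi> T \<le> gain / 2 * B" if T: "h < T" for T
  proof (cases "T \<le> 2 * h")
    case True
    have "P T - (L * B) * T \<le> P (T - h) - (L * B) * (T - h)"
    proof (rule le_by_derivative[where f = "\<lambda>s. P s - (L * B) * s" and f' = "\<lambda>s. \<bar>\<psi> s\<bar> - (L * B) * 1"])
      fix s assume s: "T - h \<le> s" "s \<le> T"
      then show "((\<lambda>s. P s - (L * B) * s) has_real_derivative \<bar>\<psi> s\<bar> - (L * B) * 1) (at s)"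
        using T by (intro DERIV_diff P' DERIV_cmult DERIV_ident) auto
      have "L * norm (v s) \<le> L * B" using B[of s] s T True L by (intro mult_left_mono) auto
      then show "\<bar>\<psi> s\<bar> - (L * B) * 1 \<le> 0" using \<psi>_le[of s] by simp
    qed (use h in simp)
    then have "\<Psi> T \<le> h * L * B" by (simp add: \<Psi>_def algebra_simps)
    also have "\<dots> \<le> gain / 2 * B"
      unfolding gain using B0 C_rate by (intro mult_right_mono) auto
    finally show ?thesis .
  next
    case False
    have "rate * (\<Psi> T)\<^sup>2 \<le> V (T - h)" using V_decrease[of T] V_nonneg[of T] T False by simp
    also have "\<dots> \<le> C * B\<^sup>2" using V[of "T - h"] False by simp
    finally have "(\<Psi> T)\<^sup>2 \<le> C / rate * B\<^sup>2" using rate_pos by (simp add: field_simps)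
    also have "\<dots> = (sqrt (C / rate) * B)\<^sup>2" using C rate_pos by (simp add: power_mult_distrib)
    finally have "\<Psi> T \<le> sqrt (C / rate) * B"
      using B0 C rate_pos by (auto intro: power2_le_imp_le)
    also have "\<dots> \<le> gain / 2 * B"
      unfolding gain using B0 h L by (intro mult_right_mono) auto
    finally show ?thesis .
  qed
  have P: "Ptot T < tol \<eta>" if "T > 2 * h" for T
    using \<Psi>B[of T] \<Psi>B[of "T - h"] that h small by (simp add: Ptot_eq)
  show "norm (v t) < \<eta>" "norm (w t) < \<eta>"
    using state_small[of "t + h" \<eta>] P \<eta> t h by auto
qed

text \<open>Along the grid of step \<open>h\<close>, \<open>V\<close> is nonincreasing and
  nonnegative, hence convergent, and its decrements dominate \<open>rate\<close> times the squares
  of \<open>\<Psi>\<close>. The grid starts at \<open>3 * h\<close> because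
  \<open>V_decrease\<close> needs a time strictly beyond \<open>2 * h\<close>.\<close>

lemma \<Psi>_grid_tendsto_0: "(\<lambda>n. \<Psi> (real (n + 3) * h)) \<longlonglongrightarrow> 0"
proof -
  define X where "X n = V (real (n + 2) * h)" for n
  have step: "X (Suc n) \<le> X n - rate * (\<Psi> (real (n + 3) * h))\<^sup>2" for n
  proof -
    have "real (n + 3) * h > 2 * h" using h by (intro mult_strict_right_mono) auto
    moreover have "real (n + 3) * h - h = real (n + 2) * h" by (simp add: algebra_simps)
    ultimately show ?thesis using V_decrease[of "real (n + 3) * h"] by (simp add: X_def eval_nat_numeral)
  qed
  have "decseq X"
    unfolding decseq_Suc_iff using step rate_pos by (smt (verit) mult_nonneg_nonneg zero_le_power2)
  moreover have "0 \<le> X n" for n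
  proof -
    have "real (n + 2) * h > 1 * h" using h by (intro mult_strict_right_mono) auto
    then show ?thesis using V_nonneg by (simp add: X_def)
  qed
  ultimately obtain l where l: "X \<longlonglongrightarrow> l" using decseq_convergent by blast
  have "(\<lambda>n. X n - X (Suc n)) \<longlonglongrightarrow> l - l" using l LIMSEQ_Suc by (intro tendsto_diff) auto
  then have "(\<lambda>n. (X n - X (Suc n)) / rate) \<longlonglongrightarrow> 0" using tendsto_divide_zero by fastforce
  then have "(\<lambda>n. (\<Psi> (real (n + 3) * h))\<^sup>2) \<longlonglongrightarrow> 0"
  proof (rule tendsto_sandwich[OF _ _ tendsto_const, rotated 2])
    show "\<forall>\<^sub>F n in sequentially. (\<Psi> (real (n + 3) * h))\<^sup>2 \<le> (X n - X (Suc n)) / rate"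
      using step rate_pos by (intro always_eventually allI) (simp add: pos_le_divide_eq algebra_simps)
  qed auto
  then show ?thesis by (simp add: power_tendsto_0_iff)
qed

text \<open>A window of length \<open>2 * h\<close> ending at an arbitrary time is covered by three
  consecutive grid cells of length \<open>h\<close>, each contributing less than
  \<open>\<kappa> / 3\<close>.\<close>

lemma Ptot_eventually_small:
  assumes "\<kappa> > 0"
  shows "\<forall>\<^sub>F T in at_top. Ptot T < \<kappa>"
proof -
  obtain n0 where n0: "\<And>n. n \<ge> n0 \<Longrightarrow> \<Psi> (real (n + 3) * h) < \<kappa> / 3"
  proof -
    have "\<forall>\<^sub>F n in sequentially. \<Psi> (real (n + 3) * h) < \<kappa> / 3"
      using \<Psi>_grid_tendsto_0 assms by (intro order_tendstoD) auto
    then show ?thesis using that by (auto simp: eventually_sequentially)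
  qed
  have "Ptot T < \<kappa>" if T: "T \<ge> real (n0 + 5) * h" for T
  proof -
    define k where "k = nat \<lfloor>T / h\<rfloor>"
    have Th: "real (n0 + 5) \<le> T / h" using T h by (simp add: field_simps)
    then have k1: "real k \<le> T / h" "T / h < real k + 1" by (auto simp: k_def)
    then have "n0 + 5 \<le> k" using Th by linarith
    then obtain n where n: "k = n + 4" "n \<ge> n0" using that[of "k - 4"] by simp
    have kh: "real k * h \<le> T" "T < (real k + 1) * h" using k1 h by (simp_all add: field_simps)
    have T0: "real (n + 2) * h \<le> T - 2 * h" "T \<le> real (n + 5) * h"
      using kh n by (simp_all add: algebra_simps)
    have n2: "0 < real (n + 2) * h" using h by simp
    then have "0 < T" using T0 h by linarith
    then have "Ptot T \<le> P (real (n + 5) * h) - P (real (n + 2) * h)"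
      unfolding Ptot_def using T0 n2 by (intro diff_mono P_mono)
    also have "\<dots> = \<Psi> (real (n + 3) * h) + \<Psi> (real (Suc n + 3) * h) + \<Psi> (real (Suc (Suc n) + 3) * h)"
    proof -
      have "real (n + 3) * h - h = real (n + 2) * h" "real (Suc n + 3) * h - h = real (n + 3) * h"
        "real (Suc (Suc n) + 3) * h - h = real (Suc n + 3) * h" "real (Suc (Suc n) + 3) * h = real (n + 5) * h"
        by (simp_all add: algebra_simps)
      then show ?thesis unfolding \<Psi>_def by (simp only:)
    qed
    also have "\<dots> < \<kappa>" using n0[of n] n0[of "Suc n"] n0[of "Suc (Suc n)"] n by simp
    finally show ?thesis .
  qed
  then show ?thesis unfolding eventually_at_top_linorder by blast
qed

lemma state_tendsto_0: "(v \<longlongrightarrow> 0) at_top" "(w \<longlongrightarrow> 0) at_top"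
proof -
  have ev: "\<forall>\<^sub>F t in at_top. norm (v t) < \<eta> \<and> norm (w t) < \<eta>" if \<eta>: "\<eta> > 0" for \<eta>
  proof -
    obtain M where M: "\<And>T. T \<ge> M \<Longrightarrow> Ptot T < tol \<eta>"
      using Ptot_eventually_small[OF tol_pos[OF \<eta>]] by (auto simp: eventually_at_top_linorder)
    have "norm (v t) < \<eta> \<and> norm (w t) < \<eta>" if "t \<ge> max M (2 * h)" for t
      using state_small[of "t + h" \<eta>] M[of "t + h"] M[of "t + h + h"] that \<eta> h by auto
    then show ?thesis unfolding eventually_at_top_linorder by blast
  qed
  show "(v \<longlongrightarrow> 0) at_top" "(w \<longlongrightarrow> 0) at_top"
    by (auto intro!: tendstoI eventually_mono[OF ev] simp: dist_norm)
qed

end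

section \<open>Differential equations\<close>

lemma integral_has_vector_derivative_atLeast:
  fixes g :: "real \<Rightarrow> 'a::banach"
  assumes "continuous_on {0..} g" "t \<ge> 0"
  shows "((\<lambda>t. integral {0..t} g) has_vector_derivative g t) (at t within {0..})"
proof -
  have "((\<lambda>t. integral {0..t} g) has_vector_derivative g t) (at t within {0..t + 1})"
    using assms by (intro integral_has_vector_derivative) (auto intro: continuous_on_subset)
  moreover have "at t within {0..t + 1} = at t within {0..}"
    by (rule at_within_nhd[where S = "{..<t + 1}"]) auto
  ultimately show ?thesis by simp
qed

lemma continuous_on_integral_atLeast:
  fixes g :: "real \<Rightarrow> 'a::banach"
  assumes "continuous_on {0..} g"
  shows "continuous_on {0..} (\<lambda>t. integral {0..t} g)"
  unfolding continuous_on_eq_continuous_within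
  using integral_has_vector_derivative_atLeast[OF assms] has_vector_derivative_continuous by blast

text \<open>Integration gains the factor \<open>1 / c\<close>; with \<open>c = 2 * K\<close> against
  the Lipschitz constant \<open>K\<close> this yields the contraction factor
  \<open>1 / 2\<close>.\<close>

lemma integral_le_exp:
  fixes g :: "real \<Rightarrow> 'a::banach"
  assumes g: "continuous_on {0..} g" and le: "\<And>s. s \<ge> 0 \<Longrightarrow> norm (g s) \<le> C * exp (c * s)"
    and c: "c > 0" and t: "t \<ge> 0"
  shows "norm (integral {0..t} g) \<le> C / c * exp (c * t)"
proof -
  have "norm (g 0) \<le> C" using le[of 0] by simp
  then have C: "C \<ge> 0" using norm_ge_zero[of "g 0"] by (rule order_trans[rotated])
  show ?thesis
  proof (cases "t = 0")
    case False
    have "norm (integral {0..t} g - integral {0..0} g) \<le> C / c * exp (c * t) - C / c * exp (c * 0)"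
    proof (rule differentiable_bound_general)
      show "continuous_on {0..t} (\<lambda>t. integral {0..t} g)"
        using continuous_on_integral_atLeast[OF g] by (rule continuous_on_subset) auto
      show "((\<lambda>t. integral {0..t} g) has_vector_derivative g s) (at s)" if s: "0 < s" "s < t" for s
        using integral_has_vector_derivative_atLeast[OF g, of s] at_within_interior[of s "{0..}"] s by simp
      show "((\<lambda>s. C / c * exp (c * s)) has_vector_derivative C * exp (c * s)) (at s)" for s
      proof -
        have "((\<lambda>s. C / c * exp (c * s)) has_real_derivative C / c * (exp (c * s) * c)) (at s)"
          by (auto intro!: derivative_eq_intros)
        then show ?thesis using c by (simp add: has_real_derivative_iff_has_vector_derivative)
      qed
      show "continuous_on {0..t} (\<lambda>s. C / c * exp (c * s))" by (intro continuous_intros)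
      show "norm (g s) \<le> C * exp (c * s)" if "0 < s" for s using le that by simp
      show "0 < t" using False t by simp
    qed
    moreover have "0 \<le> C / c" using C c by simp
    ultimately show ?thesis by simp
  qed (use C c in simp)
qed

text \<open>
  Global existence: in the weight \<open>exp (- 2 K t)\<close> the Picard operator is a contraction of the
  bounded continuous functions.
\<close>

lemma lipschitz_forward_solution_exists:
  fixes f :: "'a::banach \<Rightarrow> 'a"
  assumes f: "L-lipschitz_on UNIV f"
  shows "\<exists>x. forward_solution f x \<and> x 0 = x0"
proof -
  define K where "K = L + 1"
  have K: "K > 0" using lipschitz_on_nonneg[OF f] by (simp add: K_def)
  have lip: "norm (f a - f b) \<le> K * norm (a - b)" for a b
  proof -
    have "norm (f a - f b) \<le> L * norm (a - b)"
      using lipschitz_onD[OF f, of a b] by (simp add: dist_norm)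
    also have "\<dots> \<le> K * norm (a - b)" by (intro mult_right_mono) (auto simp: K_def)
    finally show ?thesis .
  qed
  have contf: "continuous_on UNIV f" by (rule lipschitz_on_continuous_on[OF f])
  \<comment> \<open>The unknown \<open>y\<close> is the weighted solution, so the field is evaluated
    at \<open>exp (2 * K * s)\<close> times \<open>y s\<close>.\<close>
  define g where "g y s = f (exp (2 * K * s) *\<^sub>R apply_bcontfun y s)" for y :: "real \<Rightarrow>\<^sub>C 'a" and s
  have contg: "continuous_on A (g y)" for y A
    unfolding g_def[abs_def]
    by (rule continuous_on_compose2[OF contf]) (auto intro!: continuous_intros)
  \<comment> \<open>\<open>max 0 t\<close> extends the operator by its value at 0 to negative times,
    so that it acts on bounded continuous functions of the whole line.\<close>
  define F where "F y t = exp (- (2 * K * max 0 t)) *\<^sub>R (x0 + integral {0..max 0 t} (g y))" for y t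
  have F_bcontfun: "F y \<in> bcontfun" for y
  proof -
    have cont: "continuous_on UNIV (F y)"
    proof -
      have "continuous_on UNIV (\<lambda>t::real. integral {0..max 0 t} (g y))"
        by (rule continuous_on_compose2[OF continuous_on_integral_atLeast[OF contg]])
           (auto intro!: continuous_intros simp: le_max_iff_disj)
      then show ?thesis unfolding F_def[abs_def] by (intro continuous_intros)
    qed
    define C where "C = norm (f 0) + K * norm y"
    have "norm (g y s) \<le> C * exp (2 * K * s)" if "s \<ge> 0" for s
    proof -
      have "norm (g y s) \<le> norm (f 0) + norm (g y s - f 0)" by (rule norm_triangle_sub)
      also have "\<dots> \<le> norm (f 0) + K * (exp (2 * K * s) * norm (apply_bcontfun y s))"
        using lip[of "exp (2 * K * s) *\<^sub>R apply_bcontfun y s" 0] by (simp add: g_def)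
      also have "\<dots> \<le> norm (f 0) * exp (2 * K * s) + K * (exp (2 * K * s) * norm y)"
        using K that norm_bounded[of y s]
        by (intro add_mono mult_left_mono) (auto simp: mult_le_cancel_left1)
      finally show ?thesis by (simp add: C_def algebra_simps)
    qed
    then have I: "norm (integral {0..\<tau>} (g y)) \<le> C / (2 * K) * exp (2 * K * \<tau>)" if "\<tau> \<ge> 0" for \<tau>
      using integral_le_exp[OF contg, of y C "2 * K" \<tau>] K that by simp
    have "norm (F y t) \<le> norm x0 + C / (2 * K)" for t
    proof -
      define \<tau> where "\<tau> = max 0 t"
      have \<tau>: "\<tau> \<ge> 0" unfolding \<tau>_def by (rule max.cobounded1)
      have "norm (F y t) = exp (- (2 * K * \<tau>)) * norm (x0 + integral {0..\<tau>} (g y))"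
        by (simp add: F_def \<tau>_def)
      also have "\<dots> \<le> exp (- (2 * K * \<tau>)) * (norm x0 + C / (2 * K) * exp (2 * K * \<tau>))"
        using I[OF \<tau>] norm_triangle_ineq[of x0 "integral {0..\<tau>} (g y)"] by (intro mult_left_mono) auto
      also have "\<dots> = exp (- (2 * K * \<tau>)) * norm x0 + C / (2 * K)"
        by (simp add: algebra_simps exp_minus)
      also have "\<dots> \<le> norm x0 + C / (2 * K)"
        using K \<tau> by (simp add: mult_left_le_one_le)
      finally show ?thesis .
    qed
    then have "bounded (range (F y))" unfolding bounded_iff by auto
    then show ?thesis using cont by (simp add: bcontfun_def)
  qed
  define \<Phi> where "\<Phi> y = Bcontfun (F y)" for y
  have \<Phi>: "apply_bcontfun (\<Phi> y) = F y" for y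
    unfolding \<Phi>_def using F_bcontfun by (simp add: Bcontfun_inverse)
  have "dist (\<Phi> y) (\<Phi> z) \<le> 1 / 2 * dist y z" for y z
  proof (rule dist_bound)
    fix t :: real
    define \<tau> where "\<tau> = max 0 t"
    have \<tau>: "\<tau> \<ge> 0" unfolding \<tau>_def by (rule max.cobounded1)
    have "norm (g y s - g z s) \<le> (K * dist y z) * exp (2 * K * s)" for s
    proof -
      have "norm (g y s - g z s) \<le> K * (exp (2 * K * s) * dist (apply_bcontfun y s) (apply_bcontfun z s))"
        using lip[of "exp (2 * K * s) *\<^sub>R apply_bcontfun y s" "exp (2 * K * s) *\<^sub>R apply_bcontfun z s"]
        by (simp add: g_def dist_norm flip: scaleR_diff_right)
      also have "\<dots> \<le> K * (exp (2 * K * s) * dist y z)"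
        using K dist_bounded[of y s z] by (intro mult_left_mono) auto
      finally show ?thesis by (simp add: mult_ac)
    qed
    then have "norm (integral {0..\<tau>} (\<lambda>s. g y s - g z s)) \<le> K * dist y z / (2 * K) * exp (2 * K * \<tau>)"
      using K \<tau> by (intro integral_le_exp continuous_on_diff contg) auto
    moreover have "integral {0..\<tau>} (\<lambda>s. g y s - g z s) = integral {0..\<tau>} (g y) - integral {0..\<tau>} (g z)"
      by (intro integral_diff integrable_continuous_real contg)
    ultimately have I: "norm (integral {0..\<tau>} (g y) - integral {0..\<tau>} (g z)) \<le> dist y z / 2 * exp (2 * K * \<tau>)"
      using K by simp
    have "dist (F y t) (F z t) = exp (- (2 * K * \<tau>)) * norm (integral {0..\<tau>} (g y) - integral {0..\<tau>} (g z))"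
      by (simp add: F_def \<tau>_def dist_norm flip: scaleR_diff_right)
    also have "\<dots> \<le> exp (- (2 * K * \<tau>)) * (dist y z / 2 * exp (2 * K * \<tau>))"
      using I by (intro mult_left_mono) auto
    also have "\<dots> = 1 / 2 * dist y z" by (simp add: exp_minus)
    finally show "dist (apply_bcontfun (\<Phi> y) t) (apply_bcontfun (\<Phi> z) t) \<le> 1 / 2 * dist y z"
      by (simp add: \<Phi>)
  qed
  then obtain y where y: "\<Phi> y = y"
    using banach_fix_type[of "1 / 2" \<Phi>] by auto
  define x where "x t = exp (2 * K * t) *\<^sub>R apply_bcontfun y t" for t
  have xF: "x t = x0 + integral {0..t} (\<lambda>s. f (x s))" if "t \<ge> 0" for t
  proof -
    have "apply_bcontfun y t = F y t" using y \<Phi>[of y] by simp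
    then have "x t = exp (2 * K * t) *\<^sub>R (exp (- (2 * K * t)) *\<^sub>R (x0 + integral {0..t} (g y)))"
      using that by (simp add: x_def F_def)
    then show ?thesis by (simp add: x_def g_def[abs_def] flip: exp_add)
  qed
  have "(x has_vector_derivative f (x t)) (at t within {0..})" if t: "t \<ge> 0" for t
  proof (rule has_vector_derivative_transform)
    have "((\<lambda>t. integral {0..t} (\<lambda>s. f (x s))) has_vector_derivative f (x t)) (at t within {0..})"
      using integral_has_vector_derivative_atLeast[OF contg t, of y] by (simp add: g_def[abs_def] x_def)
    then show "((\<lambda>t. x0 + integral {0..t} (\<lambda>s. f (x s))) has_vector_derivative f (x t)) (at t within {0..})"
      using has_vector_derivative_add[OF has_vector_derivative_const] by fastforce
  qed (use t xF in auto)
  moreover have "x 0 = x0" using xF[of 0] by simp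
  ultimately show ?thesis unfolding forward_solution_def by blast
qed

lemma forward_solution_derivative:
  assumes "forward_solution f x" "t > 0"
  shows "(x has_vector_derivative f (x t)) (at t)"
proof -
  have "(x has_vector_derivative f (x t)) (at t within {0..})"
    using assms by (simp add: forward_solution_def)
  moreover have "at t within {0..} = at t" using assms by (intro at_within_interior) simp
  ultimately show ?thesis by simp
qed

text \<open>A Gronwall bound: the squared norm times \<open>exp (- 2 M t)\<close> has nonpositive
  derivative. It controls the solution on the initial window, before the Lyapunov functional is
  available.\<close>

lemma forward_solution_growth:
  fixes f :: "'a::real_inner \<Rightarrow> 'a"
  assumes x: "forward_solution f x" and M: "\<And>z. norm (f z) \<le> M * norm z" and t: "t \<ge> 0"
  shows "norm (x t) \<le> exp (M * t) * norm (x 0)"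
proof -
  define q where "q t = exp (- (2 * M * t)) * (x t \<bullet> x t)" for t
  have "q 0 \<ge> q t"
  proof (rule DERIV_nonpos_imp_decreasing_open[OF t])
    fix s assume s: "0 < s" "s < t"
    have "((\<lambda>t. exp (- (2 * M * t))) has_real_derivative exp (- (2 * M * s)) * - (2 * M)) (at s)"
      by (auto intro!: derivative_eq_intros)
    from DERIV_mult'[OF this has_vector_derivative_inner[OF forward_solution_derivative[OF x s(1)] forward_solution_derivative[OF x s(1)]]]
    have "(q has_real_derivative exp (- (2 * M * s)) * (x s \<bullet> f (x s) + f (x s) \<bullet> x s)
        + exp (- (2 * M * s)) * - (2 * M) * (x s \<bullet> x s)) (at s)"
      by (simp only: q_def[abs_def])
    moreover have "exp (- (2 * M * s)) * (x s \<bullet> f (x s) + f (x s) \<bullet> x s)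
        + exp (- (2 * M * s)) * - (2 * M) * (x s \<bullet> x s) \<le> 0"
    proof -
      have "x s \<bullet> f (x s) \<le> norm (x s) * (M * norm (x s))"
        using norm_cauchy_schwarz[of "x s" "f (x s)"] mult_left_mono[OF M[of "x s"], of "norm (x s)"] by simp
      also have "\<dots> = M * (x s \<bullet> x s)" by (simp add: dot_square_norm power2_eq_square)
      finally have "exp (- (2 * M * s)) * (2 * (x s \<bullet> f (x s)) - 2 * M * (x s \<bullet> x s)) \<le> 0"
        by (intro mult_nonneg_nonpos) auto
      then show ?thesis by (simp add: algebra_simps inner_commute)
    qed
    ultimately show "\<exists>y. (q has_real_derivative y) (at s) \<and> y \<le> 0" by blast
  next
    have "continuous_on {0..} x"
      unfolding continuous_on_eq_continuous_within
      using x unfolding forward_solution_def by (metis atLeast_iff has_vector_derivative_continuous)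
    then have "continuous_on {0..t} x" by (rule continuous_on_subset) auto
    then show "continuous_on {0..t} q" unfolding q_def[abs_def] by (intro continuous_intros)
  qed
  then have "exp (- (2 * M * t)) * (norm (x t))\<^sup>2 \<le> (norm (x 0))\<^sup>2"
    by (simp add: q_def power2_norm_eq_inner)
  from mult_left_mono[OF this, of "exp (2 * M * t)"]
  have "(norm (x t))\<^sup>2 \<le> exp (2 * M * t) * (norm (x 0))\<^sup>2"
    by (simp flip: mult.assoc exp_add)
  also have "\<dots> = (exp (M * t) * norm (x 0))\<^sup>2"
    using exp_double[of "M * t"] by (simp add: power_mult_distrib mult.assoc)
  finally show ?thesis by (rule power2_le_imp_le) simp
qed

section \<open>Controllability of the double integrator\<close>

lemma vector_4:
  "(vector [x, y, z, w] :: ('a::zero)^4) $ 1 = x"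
  "(vector [x, y, z, w] :: ('a::zero)^4) $ 2 = y"
  "(vector [x, y, z, w] :: ('a::zero)^4) $ 3 = z"
  "(vector [x, y, z, w] :: ('a::zero)^4) $ 4 = w"
  unfolding vector_def by simp_all

lemma J2_mult:
  "(J2 \<omega> *v x) $ 1 = - \<omega> * x $ 2 + x $ 3"
  "(J2 \<omega> *v x) $ 2 = \<omega> * x $ 1 + x $ 4"
  "(J2 \<omega> *v x) $ 3 = - \<omega> * x $ 4"
  "(J2 \<omega> *v x) $ 4 = \<omega> * x $ 3"
  by (simp_all add: J2_def matrix_vector_mult_def sum_4 vector_4)

text \<open>Otherwise the last two components form an unforced rotation, which preserves the sum of
  their squares, so the third unit vector cannot be reached from the origin.\<close>

lemma controllable_J2_imp:
  assumes "controllable (J2 \<omega>) b"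
  shows "b $ 3 \<noteq> 0 \<or> b $ 4 \<noteq> 0"
proof (rule ccontr)
  assume "\<not> ?thesis"
  then have b: "b $ 3 = 0" "b $ 4 = 0" by auto
  from assms obtain T :: real and u x where T: "T > 0"
    and I0: "\<forall>t\<in>{0..T}. ((\<lambda>s. J2 \<omega> *v x s + u s *\<^sub>R b) has_integral (x t - 0)) {0..t}"
    and xT: "x T = axis 3 1"
    unfolding controllable_def by blast
  have I: "((\<lambda>s. J2 \<omega> *v x s + u s *\<^sub>R b) has_integral (x t - 0)) {0..t}" if "t \<in> {0..T}" for t
    using I0 that by blast
  have comp: "((\<lambda>s. (J2 \<omega> *v x s + u s *\<^sub>R b) $ i) has_integral x t $ i) {0..t}" if "t \<in> {0..T}" for t i
    using has_integral_linear[OF I[OF that] bounded_linear_vec_nth, of i] by (simp add: o_def)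
  have I3: "((\<lambda>s. - \<omega> * x s $ 4) has_integral x t $ 3) {0..t}"
    and I4: "((\<lambda>s. \<omega> * x s $ 3) has_integral x t $ 4) {0..t}" if "t \<in> {0..T}" for t
    using comp[OF that, of 3] comp[OF that, of 4] by (simp_all add: J2_mult b)
  \<comment> \<open>Regularity is bootstrapped: indefinite integrals are continuous, so the
    integrands of these two components are continuous, and the components are
    differentiable.\<close>
  have cont: "continuous_on {0..T} (\<lambda>t. x t $ 3)" "continuous_on {0..T} (\<lambda>t. x t $ 4)"
  proof -
    have "continuous_on {0..T} (\<lambda>t. integral {0..t} (\<lambda>s. - \<omega> * x s $ 4))"
      using I3[of T] T by (intro indefinite_integral_continuous_1) (auto simp: integrable_on_def)
    then show "continuous_on {0..T} (\<lambda>t. x t $ 3)"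
      by (rule continuous_on_eq) (rule integral_unique[OF I3])
    have "continuous_on {0..T} (\<lambda>t. integral {0..t} (\<lambda>s. \<omega> * x s $ 3))"
      using I4[of T] T by (intro indefinite_integral_continuous_1) (auto simp: integrable_on_def)
    then show "continuous_on {0..T} (\<lambda>t. x t $ 4)"
      by (rule continuous_on_eq) (rule integral_unique[OF I4])
  qed
  have d3: "((\<lambda>t. x t $ 3) has_real_derivative - \<omega> * x t $ 4) (at t)"
    and d4: "((\<lambda>t. x t $ 4) has_real_derivative \<omega> * x t $ 3) (at t)" if t: "0 < t" "t < T" for t
  proof -
    have w: "at t within {0..T} = at t" using t by (intro at_within_interior) simp
    have "((\<lambda>t. integral {0..t} (\<lambda>s. - \<omega> * x s $ 4)) has_real_derivative - \<omega> * x t $ 4) (at t within {0..T})"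
      by (rule integral_has_real_derivative) (use t cont in \<open>auto intro!: continuous_intros\<close>)
    then have "((\<lambda>t. x t $ 3) has_real_derivative - \<omega> * x t $ 4) (at t within {0..T})"
    proof (rule has_field_derivative_transform_within[where d = 1])
      show "integral {0..s} (\<lambda>s. - \<omega> * x s $ 4) = x s $ 3" if "s \<in> {0..T}" for s
        by (rule integral_unique[OF I3[OF that]])
    qed (use t in auto)
    then show "((\<lambda>t. x t $ 3) has_real_derivative - \<omega> * x t $ 4) (at t)" by (simp only: w)
    have "((\<lambda>t. integral {0..t} (\<lambda>s. \<omega> * x s $ 3)) has_real_derivative \<omega> * x t $ 3) (at t within {0..T})"
      by (rule integral_has_real_derivative) (use t cont in \<open>auto intro!: continuous_intros\<close>)
    then have "((\<lambda>t. x t $ 4) has_real_derivative \<omega> * x t $ 3) (at t within {0..T})"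
    proof (rule has_field_derivative_transform_within[where d = 1])
      show "integral {0..s} (\<lambda>s. \<omega> * x s $ 3) = x s $ 4" if "s \<in> {0..T}" for s
        by (rule integral_unique[OF I4[OF that]])
    qed (use t in auto)
    then show "((\<lambda>t. x t $ 4) has_real_derivative \<omega> * x t $ 3) (at t)" by (simp only: w)
  qed
  have "(x T $ 3)\<^sup>2 + (x T $ 4)\<^sup>2 = (x 0 $ 3)\<^sup>2 + (x 0 $ 4)\<^sup>2"
  proof (rule DERIV_isconst_end[OF T])
    show "continuous_on {0..T} (\<lambda>t. (x t $ 3)\<^sup>2 + (x t $ 4)\<^sup>2)" by (intro continuous_intros cont)
    show "((\<lambda>t. (x t $ 3)\<^sup>2 + (x t $ 4)\<^sup>2) has_real_derivative 0) (at t)" if "0 < t" "t < T" for t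
      using DERIV_add[OF DERIV_power[OF d3[OF that], of 2] DERIV_power[OF d4[OF that], of 2]] by simp
  qed
  \<comment> \<open>The initial state is encoded only by the integral equation at
    \<open>t = 0\<close>, whose integral over a single point vanishes.\<close>
  moreover have "x 0 = 0" using has_integral_unique[OF I[of 0, unfolded atLeastAtMost_singleton] has_integral_refl(2)] T by simp
  ultimately show False by (simp add: xT axis_def)
qed

section \<open>The closed loop\<close>

text \<open>With each coordinate pair read as a complex number, the rotation block of
  \<open>J2 \<omega>\<close> becomes multiplication by \<open>\<i> * \<omega>\<close>.\<close>

definition z1 :: "real^4 \<Rightarrow> complex" where "z1 x = Complex (x $ 1) (x $ 2)"
definition z2 :: "real^4 \<Rightarrow> complex" where "z2 x = Complex (x $ 3) (x $ 4)"

lemma z1_J2: "z1 (J2 \<omega> *v x) = \<i> * of_real \<omega> * z1 x + z2 x"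
  and z2_J2: "z2 (J2 \<omega> *v x) = \<i> * of_real \<omega> * z2 x"
  by (simp_all add: z1_def z2_def J2_mult complex_eq_iff)

lemma z_simps:
  "z1 (x + y) = z1 x + z1 y" "z2 (x + y) = z2 x + z2 y"
  "z1 (x - y) = z1 x - z1 y" "z2 (x - y) = z2 x - z2 y"
  "z1 (r *\<^sub>R x) = of_real r * z1 x" "z2 (r *\<^sub>R x) = of_real r * z2 x"
  by (simp_all add: z1_def z2_def complex_eq_iff)

lemma z_eq_0: "z1 x = 0 \<Longrightarrow> z2 x = 0 \<Longrightarrow> x = 0"
  by (simp add: z1_def z2_def complex_eq_iff vec_eq_iff forall_4)

text \<open>
  In the coordinates \<open>\<zeta>1\<close>, \<open>\<zeta>2\<close> the double integrator keeps its form and \<open>b\<close> becomes \<open>(0, 1)\<close>.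
\<close>

definition \<zeta>2 :: "real^4 \<Rightarrow> real^4 \<Rightarrow> complex" where "\<zeta>2 b x = z2 x / z2 b"
definition \<zeta>1 :: "real^4 \<Rightarrow> real^4 \<Rightarrow> complex" where
  "\<zeta>1 b x = z1 x / z2 b - z1 b / (z2 b)\<^sup>2 * z2 x"

lemma linear_\<zeta>: "linear (\<zeta>1 b)" "linear (\<zeta>2 b)"
  by (auto intro!: linearI simp: \<zeta>1_def \<zeta>2_def z_simps scaleR_conv_of_real[where 'a = complex]
      add_divide_distrib algebra_simps)

text \<open>The coordinates apply the inverse of the triangular complex matrix with diagonal
  \<open>z2 b\<close> and upper corner \<open>z1 b\<close>. That matrix commutes with the Jordan
  block and maps \<open>(0, 1)\<close> to \<open>b\<close>.\<close>

lemma \<zeta>_field: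
  assumes "z2 b \<noteq> 0"
  shows "\<zeta>1 b (J2 \<omega> *v x - s *\<^sub>R b) = \<i> * of_real \<omega> * \<zeta>1 b x + \<zeta>2 b x"
    and "\<zeta>2 b (J2 \<omega> *v x - s *\<^sub>R b) = \<i> * of_real \<omega> * \<zeta>2 b x - of_real s"
  using assms
  by (simp_all add: \<zeta>1_def \<zeta>2_def z_simps z1_J2 z2_J2 field_simps power2_eq_square)

context slow_saturated_feedback
begin

text \<open>Along the closed loop its derivative is \<open>\<i> * \<omega>\<close> times itself plus
  \<open>k1 \<zeta>2\<close> minus \<open>k2\<close> times the saturated input. Rotation therefore
  turns it into \<open>v\<close>, with \<open>k1 \<zeta>2\<close> turning into
  \<open>w\<close>.\<close>

definition feedback :: "real^4 \<Rightarrow> real^4 \<Rightarrow> complex" where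
  "feedback b x = k1 *\<^sub>R \<zeta>1 b x + k2 *\<^sub>R \<zeta>2 b x"

text \<open>The adjoint of a real functional evaluated at 1 is its Riesz vector.\<close>

definition K :: "real^4 \<Rightarrow> real^4" where
  "K b = adjoint (\<lambda>x. Re (feedback b x)) 1"

lemma linear_feedback: "linear (feedback b)"
  unfolding feedback_def[abs_def] using linear_\<zeta>
  by (intro linear_compose_add linear_compose_scale_right) auto

lemma K_inner: "K b \<bullet> x = Re (feedback b x)"
proof -
  have "linear (\<lambda>x. Re (feedback b x))"
    using linear_compose[OF linear_feedback[of b] bounded_linear.linear[OF bounded_linear_Re]]
    by (simp add: o_def)
  from adjoint_works[OF this, of x 1] show ?thesis
    by (simp add: K_def inner_commute)
qed

definition closed_loop :: "real^4 \<Rightarrow> real^4 \<Rightarrow> real^4" where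
  "closed_loop b x = J2 \<omega> *v x - \<sigma> (K b \<bullet> x) *\<^sub>R b"

lemma closed_loop_lipschitz:
  obtains M where "M-lipschitz_on UNIV (closed_loop b)" "M > 0"
proof -
  define N where "N = onorm ((*v) (J2 \<omega>))"
  define M where "M = N + L * norm (K b) * norm b + 1"
  have bl: "bounded_linear ((*v) (J2 \<omega>))" by (rule matrix_vector_mul_bounded_linear)
  have N: "N \<ge> 0" unfolding N_def by (rule onorm_pos_le[OF bl])
  have M: "M > 0" using N L by (simp add: M_def add_nonneg_pos)
  have "norm (closed_loop b x - closed_loop b y) \<le> M * norm (x - y)" for x y
  proof -
    have "closed_loop b x - closed_loop b y = J2 \<omega> *v (x - y) - (\<sigma> (K b \<bullet> x) - \<sigma> (K b \<bullet> y)) *\<^sub>R b"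
      by (simp add: closed_loop_def matrix_vector_mult_diff_distrib algebra_simps)
    also have "norm \<dots> \<le> norm (J2 \<omega> *v (x - y)) + \<bar>\<sigma> (K b \<bullet> x) - \<sigma> (K b \<bullet> y)\<bar> * norm b"
      using norm_triangle_ineq4[of "J2 \<omega> *v (x - y)"] by (metis norm_scaleR)
    also have "\<bar>\<sigma> (K b \<bullet> x) - \<sigma> (K b \<bullet> y)\<bar> \<le> L * (norm (K b) * norm (x - y))"
      using order_trans[OF lip[of "K b \<bullet> x" "K b \<bullet> y"] mult_left_mono[OF Cauchy_Schwarz_ineq2[of "K b" "x - y"], of L, unfolded inner_diff_right]] L
      by simp
    also have "norm (J2 \<omega> *v (x - y)) \<le> N * norm (x - y)"
      unfolding N_def by (rule onorm[OF bl])
    finally have "norm (closed_loop b x - closed_loop b y)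
        \<le> N * norm (x - y) + L * (norm (K b) * norm (x - y)) * norm b"
      by (simp add: mult_right_mono)
    also have "\<dots> \<le> M * norm (x - y)" by (simp add: M_def algebra_simps)
    finally show ?thesis .
  qed
  then have "M-lipschitz_on UNIV (closed_loop b)"
    using M by (auto intro!: lipschitz_onI simp: dist_norm)
  then show ?thesis using that M by blast
qed

text \<open>Multiplication by \<open>e\<close> cancels the rotation terms. Since \<open>e\<close>
  has modulus one, the inner product of \<open>e t * feedback b (x t)\<close> with
  \<open>e t\<close> is the real part of the feedback, hence the actual input.\<close>

lemma closed_loop_trajectory:
  assumes b: "z2 b \<noteq> 0" and x: "forward_solution (closed_loop b) x"
  shows "slow_trajectory \<sigma> \<Sigma> L m \<gamma> \<omega> k1 k2
    (\<lambda>t. e t * feedback b (x t)) (\<lambda>t. e t * (k1 *\<^sub>R \<zeta>2 b (x t)))"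
proof
  fix t :: real assume t: "t > 0"
  have e': "(e has_vector_derivative - (\<i> * of_real \<omega>) * e t) (at t)"
  proof -
    have "((\<lambda>t. exp (of_real t * (- \<i> * of_real \<omega>))) has_vector_derivative
        exp (of_real t * (- \<i> * of_real \<omega>)) * (- \<i> * of_real \<omega>)) (at t)"
      by (rule exp_scaleR_has_vector_derivative_right[of "- \<i> * of_real \<omega>", unfolded scaleR_conv_of_real])
    moreover have "e = (\<lambda>t. exp (of_real t * (- \<i> * of_real \<omega>)))"
      by (simp add: e_def[abs_def] cis_conv_exp mult_ac)
    ultimately show ?thesis by (simp add: mult_ac)
  qed
  define s where "s = \<sigma> (K b \<bullet> x t)"
  have x': "(x has_vector_derivative J2 \<omega> *v x t - s *\<^sub>R b) (at t)"
    using forward_solution_derivative[OF x t] by (simp add: closed_loop_def s_def)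
  have d: "((\<lambda>t. f (x t)) has_vector_derivative f (J2 \<omega> *v x t - s *\<^sub>R b)) (at t)"
    if "linear f" for f :: "real^4 \<Rightarrow> complex"
    using bounded_linear.has_vector_derivative[OF _ x'] that linear_conv_bounded_linear by blast
  have ee: "e t * cnj (e t) = 1" "cnj (e t) * e t = 1"
    by (simp_all add: e_def cis_cnj cis_mult)
  have "(e t * feedback b (x t)) \<bullet> e t = Re (e t * feedback b (x t) * cnj (e t))"
    by (simp add: inner_complex_def)
  also have "e t * feedback b (x t) * cnj (e t) = feedback b (x t)"
    using ee(1) by (metis mult.assoc mult.commute mult_1)
  finally have s: "\<sigma> ((e t * feedback b (x t)) \<bullet> e t) = s"
    by (simp add: s_def K_inner)
  have F: "feedback b (J2 \<omega> *v x t - s *\<^sub>R b)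
      = \<i> * of_real \<omega> * feedback b (x t) + k1 *\<^sub>R \<zeta>2 b (x t) - of_real (k2 * s)"
    by (simp add: feedback_def \<zeta>_field[OF b] scaleR_conv_of_real[where 'a = complex] algebra_simps)
  have G: "\<zeta>2 b (J2 \<omega> *v x t - s *\<^sub>R b) = \<i> * of_real \<omega> * \<zeta>2 b (x t) - of_real s"
    by (rule \<zeta>_field[OF b])
  show "((\<lambda>t. e t * feedback b (x t)) has_vector_derivative
      e t * (k1 *\<^sub>R \<zeta>2 b (x t)) - (k2 * \<sigma> ((e t * feedback b (x t)) \<bullet> e t)) *\<^sub>R e t) (at t)"
    using has_vector_derivative_mult[OF e' d[OF linear_feedback[of b]]]
    unfolding F s by (simp add: scaleR_conv_of_real[where 'a = complex] algebra_simps)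
  have "((\<lambda>t. e t * (k1 *\<^sub>R \<zeta>2 b (x t))) has_vector_derivative
      e t * (k1 *\<^sub>R \<zeta>2 b (J2 \<omega> *v x t - s *\<^sub>R b)) + (- (\<i> * of_real \<omega>) * e t) * (k1 *\<^sub>R \<zeta>2 b (x t))) (at t)"
    using has_vector_derivative_mult[OF e' d[OF linear_compose_scale_right[OF linear_\<zeta>(2)]]] by simp
  then show "((\<lambda>t. e t * (k1 *\<^sub>R \<zeta>2 b (x t))) has_vector_derivative
      - (k1 * \<sigma> ((e t * feedback b (x t)) \<bullet> e t)) *\<^sub>R e t) (at t)"
    unfolding G s by (simp add: scaleR_conv_of_real[where 'a = complex] algebra_simps)
qed

text \<open>The map \<open>G\<close> from the state to the pair of feedback and
  \<open>k1 \<zeta>2\<close> is linear and injective, and the rotation preserves norms. So the state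
  is small exactly when \<open>V\<close> and \<open>W\<close> are, and both stability properties
  transfer from the rotating frame.\<close>

lemma closed_loop_stable:
  assumes b: "z2 b \<noteq> 0"
  shows "globally_asymptotically_stable (closed_loop b)"
proof -
  obtain M where M: "M-lipschitz_on UNIV (closed_loop b)" "M > 0"
    by (rule closed_loop_lipschitz)
  have zero: "closed_loop b 0 = 0" by (simp add: closed_loop_def)
  have growth: "norm (closed_loop b x) \<le> M * norm x" for x
    using lipschitz_onD[OF M(1), of x 0] by (simp add: zero dist_norm)
  define V where "V x t = e t * feedback b (x t)" for x t
  define W where "W x t = e t * (k1 *\<^sub>R \<zeta>2 b (x t))" for x t
  have traj: "slow_trajectory \<sigma> \<Sigma> L m \<gamma> \<omega> k1 k2 (V x) (W x)"
    if "forward_solution (closed_loop b) x" for x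
    unfolding V_def[abs_def] W_def[abs_def] using closed_loop_trajectory[OF b that] .
  define G where "G x = (feedback b x, k1 *\<^sub>R \<zeta>2 b x)" for x
  have linG: "linear G"
    unfolding G_def[abs_def]
    by (intro linearI) (auto simp: linear_add[OF linear_feedback] linear_scale[OF linear_feedback]
        linear_add[OF linear_\<zeta>(2)] linear_scale[OF linear_\<zeta>(2)] scaleR_add_right)
  have injG: "inj G"
    unfolding linear_injective_0[OF linG]
  proof (intro allI impI)
    fix x assume "G x = 0"
    then have 2: "\<zeta>2 b x = 0" and "feedback b x = 0"
      using k1 by (auto simp: G_def zero_prod_def)
    then have 1: "\<zeta>1 b x = 0" using k1 by (simp add: feedback_def)
    have "z2 x = 0" using 2 b by (simp add: \<zeta>2_def)
    moreover have "z1 x = 0" using 1 b \<open>z2 x = 0\<close> by (simp add: \<zeta>1_def)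
    ultimately show "x = 0" by (rule z_eq_0[rotated])
  qed
  obtain B where B: "B > 0" "\<And>x. B * norm x \<le> norm (G x)"
    using linear_inj_bounded_below_pos[OF linG injG] by blast
  obtain C where C: "C > 0" "\<And>x. norm (G x) \<le> C * norm x"
    using linear_bounded_pos[OF linG] by blast
  have GVW: "norm (G (x t)) \<le> norm (V x t) + norm (W x t)"
    and VG: "norm (V x t) \<le> norm (G (x t))" and WG: "norm (W x t) \<le> norm (G (x t))" for x t
    using norm_Pair_le[of "feedback b (x t)" "k1 *\<^sub>R \<zeta>2 b (x t)"]
      norm_fst_le[of "feedback b (x t)" "k1 *\<^sub>R \<zeta>2 b (x t)"]
      norm_snd_le[of "k1 *\<^sub>R \<zeta>2 b (x t)" "feedback b (x t)"]
    by (simp_all add: V_def W_def G_def norm_mult)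
  show ?thesis
    unfolding globally_asymptotically_stable_def
  proof (intro conjI allI impI)
    show "closed_loop b 0 = 0" by (rule zero)
    show "\<exists>x. forward_solution (closed_loop b) x \<and> x 0 = x0" for x0
      by (rule lipschitz_forward_solution_exists[OF M(1)])
    show "\<exists>\<delta>>0. \<forall>x. forward_solution (closed_loop b) x \<and> norm (x 0) < \<delta> \<longrightarrow>
        (\<forall>t\<ge>0. norm (x t) < \<epsilon>)" if \<epsilon>: "\<epsilon> > 0" for \<epsilon> :: real
    proof -
      \<comment> \<open>Two components below \<open>\<eta>\<close> bound \<open>G\<close> by
        \<open>B * \<epsilon>\<close>, hence the state by \<open>\<epsilon>\<close>.\<close>
      define \<eta> where "\<eta> = B * \<epsilon> / 2"
      have \<eta>: "\<eta> > 0" using B \<epsilon> by (simp add: \<eta>_def)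
      define Q where "Q = exp (M * (2 * h))"
      have Q: "Q > 0" by (simp add: Q_def)
      \<comment> \<open>The first entry treats times up to \<open>h\<close> by the growth bound; the
        second makes the initial window small enough for \<open>bounded_by_initial_window\<close>,
        which covers all times after \<open>h\<close>.\<close>
      define \<delta> where "\<delta> = min (\<epsilon> / Q) (tol \<eta> / (gain * C * Q))"
      have \<delta>: "\<delta> > 0" using \<epsilon> Q C gain_pos tol_pos[OF \<eta>] by (simp add: \<delta>_def)
      have "norm (x t) < \<epsilon>" if x: "forward_solution (closed_loop b) x" "norm (x 0) < \<delta>" and t: "t \<ge> 0" for x t
      proof -
        have early: "norm (x s) \<le> Q * norm (x 0)" if s: "0 \<le> s" "s \<le> 2 * h" for s
        proof -
          have "norm (x s) \<le> exp (M * s) * norm (x 0)"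
            by (rule forward_solution_growth[OF x(1) growth s(1)])
          also have "\<dots> \<le> Q * norm (x 0)" using s M by (intro mult_right_mono) (auto simp: Q_def)
          finally show ?thesis .
        qed
        show ?thesis
        proof (cases "t \<le> h")
          case True
          have "norm (x t) \<le> Q * norm (x 0)" using early[of t] t True h by simp
          also have "\<dots> < Q * \<delta>" using Q x by simp
          also have "\<dots> \<le> Q * (\<epsilon> / Q)" using Q by (intro mult_left_mono) (auto simp: \<delta>_def)
          finally show ?thesis using Q by simp
        next
          case False
          interpret tr: slow_trajectory \<sigma> \<Sigma> L m \<gamma> \<omega> k1 k2 h "V x" "W x"
            "\<lambda>t. V x t \<bullet> e t" "\<lambda>t. \<sigma> (V x t \<bullet> e t)"
            using traj[OF x(1)] by (simp_all add: h_def)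
          have bd: "norm (G (x s)) \<le> C * (Q * norm (x 0))" if "0 < s" "s \<le> 2 * h" for s
            using order_trans[OF C(2)[of "x s"]] mult_left_mono[OF early[of s], of C] that C by simp
          have "gain * (C * (Q * norm (x 0))) = (gain * C * Q) * norm (x 0)" by simp
          also have "\<dots> < (gain * C * Q) * \<delta>"
            using gain_pos C Q x by (intro mult_strict_left_mono) auto
          also have "\<dots> \<le> (gain * C * Q) * (tol \<eta> / (gain * C * Q))"
            using gain_pos C Q by (intro mult_left_mono) (auto simp: \<delta>_def)
          also have "\<dots> = tol \<eta>" using gain_pos C Q by simp
          finally have small: "gain * (C * (Q * norm (x 0))) < tol \<eta>" .
          have init: "norm (V x s) \<le> C * (Q * norm (x 0)) \<and> norm (W x s) \<le> C * (Q * norm (x 0))"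
            if "0 < s" "s \<le> 2 * h" for s
            using bd[OF that] VG[of x s] WG[of x s] by linarith
          have "norm (V x t) < \<eta>" "norm (W x t) < \<eta>"
            using tr.bounded_by_initial_window[OF init small \<eta>, of t] False by auto
          then have "B * norm (x t) < B * \<epsilon>"
            using B(2)[of "x t"] GVW[of x t] by (simp add: \<eta>_def)
          then show ?thesis using B by simp
        qed
      qed
      then show ?thesis using \<delta> by blast
    qed
    show "(x \<longlongrightarrow> 0) at_top" if x: "forward_solution (closed_loop b) x" for x
    proof -
      interpret tr: slow_trajectory \<sigma> \<Sigma> L m \<gamma> \<omega> k1 k2 h "V x" "W x"
        "\<lambda>t. V x t \<bullet> e t" "\<lambda>t. \<sigma> (V x t \<bullet> e t)"
        using traj[OF x] by (simp_all add: h_def)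
      have "((\<lambda>t. (norm (V x t) + norm (W x t)) / B) \<longlongrightarrow> (norm (0::complex) + norm (0::complex)) / B) at_top"
        using B by (intro tendsto_intros tr.state_tendsto_0) auto
      then have "((\<lambda>t. (norm (V x t) + norm (W x t)) / B) \<longlongrightarrow> 0) at_top" by simp
      moreover have "norm (x t) \<le> (norm (V x t) + norm (W x t)) / B" for t
        using B order_trans[OF B(2) GVW, of x t] by (simp add: pos_le_divide_eq mult.commute)
      ultimately show ?thesis
        by (intro Lim_null_comparison[of x]) (auto intro: always_eventually)
    qed
  qed
qed

end

theorem theorem4:
  fixes \<sigma> :: "real \<Rightarrow> real" and \<omega> :: real and b :: "real^4"
  assumes "saturation_function \<sigma>"
    and "\<omega> > 0"
    and "controllable (J2 \<omega>) b"
  shows "\<exists>K :: real^4. globally_asymptotically_stable (\<lambda>x. J2 \<omega> *v x - \<sigma> (K \<bullet> x) *\<^sub>R b)"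
proof -
  obtain L m \<gamma> where c: "L > 0" "m > 0" "0 < \<gamma>" "\<gamma> \<le> 1"
    "\<And>x y. \<bar>\<sigma> x - \<sigma> y\<bar> \<le> L * \<bar>x - y\<bar>"
    "\<And>x. 0 \<le> x \<Longrightarrow> m * min x 1 \<le> \<sigma> x"
    "\<And>x c. 0 \<le> x \<Longrightarrow> 0 \<le> c \<Longrightarrow> c \<le> 1 \<Longrightarrow> \<gamma> * c * \<sigma> x \<le> \<sigma> (c * x)"
    by (rule saturation_function_bounds[OF assms(1)]) blast
  have odd: "\<And>x. \<sigma> (- x) = - \<sigma> x" and mono: "mono \<sigma>"
    using assms(1) by (auto simp: saturation_function_def)
  have "L-lipschitz_on UNIV \<sigma>" using c by (auto intro!: lipschitz_onI simp: dist_real_def)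
  then have "isCont \<sigma> x" for x
    using lipschitz_on_continuous_on continuous_on_eq_continuous_at by blast
  then obtain F where F: "\<And>x. (F has_real_derivative \<sigma> x) (at x)"
    using einterval_antiderivative[of "-\<infinity>" \<infinity> \<sigma>]
    by (auto simp: has_real_derivative_iff_has_vector_derivative)
  define h where "h = pi / \<omega>"
  have h: "h > 0" using assms(2) by (simp add: h_def)
  \<comment> \<open>The first entry yields \<open>slow1\<close> because
    \<open>h * k1 \<le> k2\<close>, and the second is \<open>slow3\<close> solved for
    \<open>k2\<close>. The choice of \<open>k1\<close> turns \<open>slow2\<close> into an
    equality.\<close>
  define k2 where "k2 = min (\<gamma> / (32 * h * L)) (1 / (2 * L * h * (9 + 64 / \<gamma>\<^sup>2)))"
  define k1 where "k1 = k2 * \<gamma>\<^sup>2 / (128 * h)"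
  have p: "0 < 9 + 64 / \<gamma>\<^sup>2" using c by (intro add_pos_pos) auto
  have k2: "k2 > 0" using c h p by (simp add: k2_def)
  have k1: "k1 > 0" using c h k2 by (simp add: k1_def)
  interpret slow_saturated_feedback \<sigma> "\<lambda>x. F x - F 0" L m \<gamma> \<omega> k1 k2 h
  proof (unfold_locales)
    show "((\<lambda>x. F x - F 0) has_real_derivative \<sigma> x) (at x)" for x
      using F by (auto intro!: derivative_eq_intros)
    have "h * k1 \<le> k2"
      using c k2 h mult_left_mono[OF power_le_one[of \<gamma> 2], of k2] by (simp add: k1_def)
    then have "16 * h * L * (k2 + h * k1) \<le> 16 * h * L * (2 * k2)"
      using c h by (intro mult_left_mono) auto
    also have "\<dots> \<le> 32 * h * L * (\<gamma> / (32 * h * L))"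
      using c h mult_left_mono[of k2 "\<gamma> / (32 * h * L)" "32 * h * L"] by (simp add: k2_def)
    also have "\<dots> = \<gamma>" using c h by simp
    finally show "16 * (pi / \<omega>) * L * (k2 + pi / \<omega> * k1) \<le> \<gamma>" by (simp only: h_def)
    show "128 * (pi / \<omega>) * k1 \<le> k2 * \<gamma>\<^sup>2"
      unfolding h_def[symmetric] using h by (simp add: k1_def)
    have "2 * L * h * k2 * (9 + 64 / \<gamma>\<^sup>2) = (2 * L * h * (9 + 64 / \<gamma>\<^sup>2)) * k2" by simp
    also have "\<dots> \<le> (2 * L * h * (9 + 64 / \<gamma>\<^sup>2)) * (1 / (2 * L * h * (9 + 64 / \<gamma>\<^sup>2)))"
      using c h p by (intro mult_left_mono) (auto simp: k2_def)
    also have "\<dots> = 1" using c h p by simp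
    finally show "2 * L * (pi / \<omega>) * k2 * (9 + 64 / \<gamma>\<^sup>2) \<le> 1" by (simp only: h_def)
  qed (use c odd mono assms(2) k1 k2 in \<open>auto simp: h_def\<close>)
  have "z2 b \<noteq> 0"
    using controllable_J2_imp[OF assms(3)] by (auto simp: z2_def complex_eq_iff)
  then show ?thesis
    using closed_loop_stable unfolding closed_loop_def[abs_def] by blast
qed

end
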